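(* There exists a set $A \subset [\sqrt{2},2]$ which is dense in $[\sqrt 2,2]$ and locally uncountable such that for every $a \in A$ the restriction $T_a : \omega(c) \to \omega(c)$ of the tent map $T_a$ to the $\omega$-limit set of its turning point $c=\frac12$ is a homeomorphism.
   Context: For $a \in (1,2]$ the tent map $T_a:[0,1]\to[0,1]$ is $T_a(x) = \min(ax, a(1-x))$; its turning point is $c = \frac12$. For $x\in[0,1]$, $\omega(x) = \bigcap_{i} \overline{\bigcup_{j \ge i} \{T_a^j(x)\}}$ is the $\omega$-limit set (under $T_a$). A dense set $A\subset[\sqrt2,2]$ is locally uncountable if $A \cap U$ is uncountable for every nonempty relatively open $U \subset [\sqrt 2, 2]$. *)

theory Defs
  imports "HOL-Analysis.Analysis"
begin

text \<open>
  The tent map is a total function on the reals; only its values on \<open>{0..1}\<close> matter, which it maps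
  into itself for \<open>0 \<le> a \<le> 2\<close>.
\<close>

definition tent_map :: "real \<Rightarrow> real \<Rightarrow> real" where
  "tent_map a x = min (a * x) (a * (1 - x))"

text \<open>
  The closure is taken in the ambient space. For an orbit that stays in a closed subspace, such as
  \<open>{0..1}\<close> inside the reals, this agrees with the closure taken in that subspace.
\<close>

definition omega_limit :: "('a::topological_space \<Rightarrow> 'a) \<Rightarrow> 'a \<Rightarrow> 'a set" where
  "omega_limit f x = (\<Inter>i::nat. closure (\<Union>j\<in>{i..}. {(f ^^ j) x}))"

definition locally_uncountable_in :: "'a::topological_space set \<Rightarrow> 'a set \<Rightarrow> bool" where
  "locally_uncountable_in S A \<longleftrightarrow>
    (\<forall>U. openin (top_of_set S) U \<and> U \<noteq> {} \<longrightarrow> uncountable (A \<inter> U))"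

end

theory Submission
  imports Defs
begin

text \<open>
  Parameters are constructed whose kneading sequence is a concatenation of words of lengths
  \<open>N 0 = 2 < N 1 < N 2 < ...\<close>, where \<open>N i\<close> divides \<open>N (i + 1)\<close> for \<open>i > 0\<close>. The orbit of the turning point
  \<open>c\<close> first follows itself for \<open>N (i + 1)\<close> steps, arrives near a point of period \<open>N i\<close> next to \<open>c\<close>, turns
  around it \<open>r i * N (i + 1)\<close> times, comes back very close to \<open>c\<close>, and shadows itself for \<open>N (i + 1)\<close> further
  steps; this brings it to a much closer point of period \<open>N (i + 1)\<close>, and so on. Since the numbers of
  turns are multiples of \<open>N (i + 1)\<close>, the orbit is close to \<open>c\<close> precisely at times divisible by some \<open>N i\<close>, as for
  an adding machine, although the map is not renormalizable. If \<open>x\<close> and \<open>1 - x\<close> were two distinct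
  limit points, their futures would agree, so that they are approached at times of the same phase modulo
  \<open>N (i + 1)\<close>; two words of length \<open>N (i + 1)\<close> in the same phase can only differ at multiples of
  \<open>N i\<close>, where the orbit is close to \<open>c\<close>. Hence \<open>x = c\<close>.

  The parameters are found by the intermediate value theorem in nested intervals, and the free choice of \<open>r i\<close>
  in \<open>{1, 2}\<close> yields uncountably many in each. The construction starts in every parameter interval beyond
  \<open>sqrt 2\<close>: since two successive iterates must cut a parameter interval that expands by more than
  \<open>sqrt 2\<close> per step, some iterate of \<open>c\<close> sweeps across the fixed point.
\<close>

section \<open>The symbolic model\<close>

lemma multiple_gap:
  fixes d x y :: nat
  assumes "d dvd x" "d dvd y" "x < y"
  shows "x + d \<le> y"
proof -
  from assms(3) have "0 < y - x" by simp
  moreover have "d dvd y - x" using assms by (simp add: dvd_diff_nat)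
  ultimately have "d \<le> y - x" by (simp add: dvd_imp_le)
  then show ?thesis using assms(3) by simp
qed

text \<open>
  With \<open>E\<close> the prefix of length \<open>N (Suc i)\<close> of \<open>e\<close>, with \<open>C\<close> the prefix of length \<open>N i\<close> whose last symbol
  is flipped, and with \<open>C'\<close> obtained likewise from \<open>E\<close>, the locale says that the prefix of length
  \<open>N (Suc (Suc i))\<close> is \<open>E C ... C C'\<close> with \<open>r i * N (Suc i)\<close> copies of \<open>C\<close>. Symbol \<open>0\<close> of \<open>e\<close> belongs to the
  turning point and is left unspecified.
\<close>

locale renorm_word =
  fixes N r :: "nat \<Rightarrow> nat" and e :: "nat \<Rightarrow> real"
  assumes N_0: "N 0 = 2" and N_1: "2 < N (Suc 0)"
    and r_pos: "0 < r i"
    and N_Suc_Suc: "N (Suc (Suc i)) = 2 * N (Suc i) + r i * N (Suc i) * N i"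
    and e_1: "e 1 = 1"
    and e_N: "e (N i) = - ((- 1) ^ i)"
    and e_pole: "j \<le> r i * N (Suc i) \<Longrightarrow> e (N (Suc i) + j * N i) = (- 1) ^ i"
    and e_lap: "j < r i * N (Suc i) \<Longrightarrow> 0 < t \<Longrightarrow> t < N i \<Longrightarrow> e (N (Suc i) + j * N i + t) = e t"
    and e_return: "0 < t \<Longrightarrow> t < N (Suc i) \<Longrightarrow>
      e (N (Suc i) + r i * N (Suc i) * N i + t) = e t"
begin

section \<open>Lengths of the levels and structure of their blocks\<close>

lemma N_less_Suc: "N i < N (Suc i)" and N_gt_1: "1 < N i"
proof -
  have "1 < N i \<and> N i < N (Suc i)"
  proof (induction i)
    case 0
    show ?case using N_0 N_1 by simp
  next
    case (Suc i)
    then show ?case using N_Suc_Suc[of i] by auto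
  qed
  then show "N i < N (Suc i)" "1 < N i" by auto
qed

lemma strict_mono_N: "strict_mono N"
  by (simp add: strict_mono_Suc_iff N_less_Suc)

text \<open>Level \<open>0\<close> is left out because \<open>N 1\<close> may be odd; above it, the
  previous length is a factor of both summands of the recursion.\<close>

lemma N_dvd_Suc: "0 < i \<Longrightarrow> N i dvd N (Suc i)"
  by (cases i) (auto simp: N_Suc_Suc)

lemma N_dvd: "0 < i \<Longrightarrow> i \<le> k \<Longrightarrow> N i dvd N k"
proof (induction k)
  case (Suc k)
  show ?case
  proof (cases "i = Suc k")
    case False
    then have "N i dvd N k" "0 < k" using Suc by auto
    then show ?thesis using N_dvd_Suc dvd_trans by blast
  qed simp
qed simp

text \<open>
  The second alternative is a block inside a run of laps at level \<open>i\<close>.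
\<close>

lemma block_types:
  assumes i: "0 < i" and "N (Suc i) dvd m"
  shows "(\<forall>t. 0 < t \<and> t < N (Suc i) \<longrightarrow> e (m + t) = e t) \<or>
    (\<forall>t. 0 < t \<and> t < N (Suc i) \<longrightarrow> e (m + t) = (if N i dvd t then (- 1) ^ i else e (t mod N i)))"
  using assms(2)
proof (induction m rule: less_induct)
  case (less m)
  show ?case
  proof (cases "m = 0")
    case False
    \<comment> \<open>A block that copies an earlier block starting at a multiple of
      \<open>N (Suc i)\<close> inherits its type from the induction hypothesis.\<close>
    have transfer: ?thesis if "m'' < m" "N (Suc i) dvd m''"
      "\<And>t. 0 < t \<Longrightarrow> t < N (Suc i) \<Longrightarrow> e (m + t) = e (m'' + t)" for m''
      using less.IH[OF that(1,2)] that(3) by force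
    have "N (Suc i) \<le> m" using False less.prems by (simp add: dvd_imp_le)
    \<comment> \<open>With \<open>N k \<le> m < N (Suc k)\<close>, the position \<open>m\<close>
      lies in the final return, in the laps of level \<open>i\<close> itself, or in the laps of a
      higher level. The first and the last case copy an earlier block; the middle one yields the
      second type.\<close>
    define k where "k = (LEAST k. m < N (Suc k))"
    have ex: "m < N (Suc m)"
      using strict_mono_N strict_mono_imp_increasing by (metis Suc_le_lessD)
    have k: "m < N (Suc k)" unfolding k_def using ex by (rule LeastI)
    have k_le: "N k \<le> m"
    proof (cases k)
      case 0
      then show ?thesis
        using \<open>N (Suc i) \<le> m\<close> strict_mono_N by (meson le0 order_trans strict_mono_less_eq)
    next
      case (Suc k')
      then have "\<not> m < N (Suc k')" using not_less_Least[of k' "\<lambda>k. m < N (Suc k)"]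
        by (simp add: k_def)
      then show ?thesis using Suc by simp
    qed
    have "Suc i \<le> k"
      using k \<open>N (Suc i) \<le> m\<close> strict_mono_less[OF strict_mono_N, of "Suc i" "Suc k"] by linarith
    then obtain k' where k': "k = Suc k'" "i \<le> k'" by (cases k) auto
    define M where "M = r k' * N (Suc k')"
    define m' where "m' = m - N (Suc k')"
    have m: "m = N (Suc k') + m'" using k_le k' by (simp add: m'_def)
    have m'_less: "m' < N (Suc k') + M * N k'"
      using k k' m N_Suc_Suc[of k'] by (simp add: M_def)
    have dvd_k: "N (Suc i) dvd N (Suc k')" using N_dvd[of "Suc i" "Suc k'"] k' by simp
    have dvd_m': "N (Suc i) dvd m'" using less.prems m dvd_k by (simp add: dvd_add_right_iff)
    have dvd_M: "N (Suc i) dvd M * N k'" using dvd_k by (simp add: M_def)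
    show ?thesis
    proof (cases "M * N k' \<le> m'")
      case True
      define m'' where "m'' = m' - M * N k'"
      have 1: "m'' < N (Suc k')" using m'_less True by (simp add: m''_def)
      have 2: "N (Suc i) dvd m''" using dvd_m' dvd_M by (simp add: m''_def dvd_diff_nat)
      have 3: "m'' + N (Suc i) \<le> N (Suc k')" using multiple_gap[OF 2 dvd_k 1] .
      have m_eq: "m = N (Suc k') + M * N k' + m''" using m True by (simp add: m''_def)
      show ?thesis
      proof (rule transfer)
        show "m'' < m" using m_eq N_gt_1[of "Suc k'"] by simp
        fix t assume "0 < t" "t < N (Suc i)"
        then show "e (m + t) = e (m'' + t)"
          using e_return[of "m'' + t" k'] 3 m_eq by (simp add: M_def add.assoc)
      qed fact
    next
      case False
      show ?thesis
      proof (cases "k' = i")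
        case True
        \<comment> \<open>The run of laps ends at a multiple of \<open>N (Suc i)\<close>, so the
          whole block fits into it.\<close>
        have gap: "m' + N (Suc i) \<le> M * N i"
          using multiple_gap[OF dvd_m'] dvd_M False True by simp
        have dvd_i: "N i dvd m'" using dvd_m' N_dvd_Suc[OF i] dvd_trans by blast
        have "e (m + t) = (if N i dvd t then (- 1) ^ i else e (t mod N i))"
          if t: "0 < t" "t < N (Suc i)" for t
        proof -
          define j where "j = (m' + t) div N i"
          have mod: "(m' + t) mod N i = t mod N i" using dvd_i by (auto elim: dvdE)
          have split: "m' + t = j * N i + t mod N i"
            using div_mult_mod_eq[of "m' + t" "N i"] mod by (simp add: j_def)
          have "m' + t < M * N i" using gap t by simp
          then have j: "j < M" by (simp add: j_def less_mult_imp_div_less)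
          have eq: "m + t = N (Suc i) + j * N i + t mod N i" using m True split by simp
          show ?thesis
          proof (cases "N i dvd t")
            case True
            then have "t mod N i = 0" by simp
            with eq have "m + t = N (Suc i) + j * N i" by simp
            then show ?thesis
              using True e_pole[of j i] j \<open>k' = i\<close> by (simp add: M_def)
          next
            case False
            then have "0 < t mod N i" by (simp add: mod_greater_zero_iff_not_dvd)
            moreover have "t mod N i < N i" using N_gt_1[of i] by simp
            ultimately show ?thesis
              unfolding eq using False e_lap[of j i "t mod N i"] j \<open>k' = i\<close> by (simp add: M_def)
          qed
        qed
        then show ?thesis by blast
      next
        case neq: False
        then have "Suc i \<le> k'" using k' by simp
        then have dvd_k': "N (Suc i) dvd N k'" using N_dvd by simp
        define m'' where "m'' = m' mod N k'"
        define j where "j = m' div N k'"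
        have 1: "m'' < N k'" using N_gt_1[of k'] by (simp add: m''_def)
        have 2: "N (Suc i) dvd m''" using dvd_m' dvd_k' by (simp add: m''_def dvd_mod)
        have 3: "m'' + N (Suc i) \<le> N k'" using multiple_gap[OF 2 dvd_k' 1] .
        have j: "j < M" using False by (simp add: j_def less_mult_imp_div_less)
        have m_eq: "m = N (Suc k') + j * N k' + m''" using m by (simp add: j_def m''_def)
        show ?thesis
        proof (rule transfer)
          show "m'' < m" using m_eq N_gt_1[of "Suc k'"] by simp
          fix t assume "0 < t" "t < N (Suc i)"
          then show "e (m + t) = e (m'' + t)"
            using e_lap[of j k' "m'' + t"] 3 m_eq j by (simp add: M_def add.assoc)
        qed fact
      qed
    qed
  qed simp
qed

text \<open>Both block types replay the prefix up to the first multiple of \<open>N i\<close>. This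
  agreement makes the orbit small at multiples of \<open>N (Suc i)\<close>.\<close>

lemma block_starts_like_prefix:
  assumes "0 < i" "N (Suc i) dvd m" "0 < t" "t < N i"
  shows "e (m + t) = e t"
  using block_types[OF assms(1,2)]
proof
  assume "\<forall>t. 0 < t \<and> t < N (Suc i) \<longrightarrow> e (m + t) = e t"
  then show ?thesis using assms N_less_Suc[of i] by simp
next
  assume *: "\<forall>t. 0 < t \<and> t < N (Suc i) \<longrightarrow>
    e (m + t) = (if N i dvd t then (- 1) ^ i else e (t mod N i))"
  have "\<not> N i dvd t" using assms by (simp add: nat_dvd_not_less)
  then show ?thesis using * assms N_less_Suc[of i] by simp
qed

section \<open>Recognising return times by the itinerary\<close>

text \<open>The last \<open>-1\<close> before the long run of \<open>1\<close>s produced by the laps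
  of level \<open>0\<close> serves as a marker. Inside a block of length \<open>N 2\<close> a run
  this long can follow a \<open>-1\<close> in one place only, so the marker fixes the phase modulo
  \<open>N 2\<close>.\<close>

lemma prefix_recognition_base:
  assumes "\<And>t. 0 < t \<Longrightarrow> t \<le> N 1 + 2 * r 0 * N 1 \<Longrightarrow> e (n + t) = e t"
  shows "N 2 dvd n"
proof -
  have two: "N (Suc (Suc 0)) = N 2" by (simp add: numeral_2_eq_2)
  define K where "K = N 1 + 2 * r 0 * N 1"
  have K3: "3 * N 1 \<le> K" using r_pos[of 0] by (simp add: K_def)
  have N2: "N 2 = K + N 1" using N_Suc_Suc[of 0] N_0 by (simp add: K_def two)
  have N1: "2 < N 1" using N_1 by simp
  have e2: "e 2 = -1" using e_N[of 0] N_0 by simp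
  have ones: "e t = 1" if t: "N 1 \<le> t" "t \<le> K" for t
  proof -
    define j where "j = (t - N 1) div 2"
    have "t = N 1 + j * 2 \<or> t = N 1 + j * 2 + 1" using t unfolding j_def by presburger
    then show ?thesis
    proof
      assume "t = N 1 + j * 2"
      moreover from this t have "j \<le> r 0 * N 1" by (simp add: K_def)
      ultimately show ?thesis using e_pole[of j 0] N_0 by simp
    next
      assume *: "t = N 1 + j * 2 + 1"
      moreover from this t have "j < r 0 * N 1" by (simp add: K_def)
      ultimately show ?thesis using e_lap[of j 0 1] N_0 e_1 by simp
    qed
  qed
  define l where "l = Max {t. t < N 1 \<and> e t = -1}"
  have fin: "finite {t. t < N 1 \<and> e t = -1}" by simp
  have "l \<in> {t. t < N 1 \<and> e t = -1}"
    unfolding l_def using N1 e2 by (intro Max_in fin) auto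
  then have l: "l < N 1" "e l = -1" by auto
  have l2: "2 \<le> l" unfolding l_def using N1 e2 by (intro Max_ge fin) simp
  have l_max: "t \<le> l" if "t < N 1" "e t = -1" for t
    unfolding l_def using that by (intro Max_ge fin) simp
  have e_pm: "e (n + t) \<noteq> -1" if "l < t" "t \<le> K" for t
  proof -
    have "e (n + t) = e t" using assms[of t] that by (simp add: K_def)
    moreover have "e t \<noteq> -1"
    proof (cases "t < N 1")
      case True
      then show ?thesis using l_max[of t] that by auto
    next
      case False
      then show ?thesis using ones[of t] that by auto
    qed
    ultimately show ?thesis by simp
  qed
  have e_l: "e (n + l) = -1" using assms[of l] l l2 K3 by (simp add: K_def)
  \<comment> \<open>\<open>f\<close> is the marker in the shifted word and \<open>x\<close> its
    phase; every phase other than \<open>l\<close> is refuted.\<close>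
  define f where "f = n + l"
  define q where "q = f div N 2 * N 2"
  define x where "x = f mod N 2"
  have f: "f = q + x" by (simp add: q_def x_def)
  have x: "x < N 2" using N_gt_1[of 2] by (simp add: x_def)
  have q_dvd: "N (Suc 1) dvd q" by (simp add: q_def two)
  have N12: "N 1 dvd N 2" using N_dvd_Suc[of 1] by (simp add: two)
  have N1K: "N 1 dvd K" by (simp add: K_def)
  have at_end: "e (q + N 2 + 2) = -1"
    using block_starts_like_prefix[of 1 "q + N 2" 2] q_dvd N1 e2 by (simp add: two)
  text \<open>A multiple of \<open>N 1\<close> shortly after \<open>f\<close> at which the orbit restarts spoils the long run of \<open>1\<close>s.\<close>
  have no: False if "e (g + 2) = -1" "f \<le> g" "g \<le> f + N 1" for g
  proof -
    have "e (n + (g + 2 - n)) \<noteq> -1"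
      using that l l2 K3 N1 by (intro e_pm) (auto simp: f_def)
    then show False using that by (simp add: f_def)
  qed
  show ?thesis
    using block_types[of 1, OF _ q_dvd]
  proof
    assume A: "\<forall>t. 0 < t \<and> t < N (Suc 1) \<longrightarrow> e (q + t) = e t"
    then have A: "e (q + t) = e t" if "0 < t" "t < N 2" for t using that by (simp add: two)
    consider "x = 0" | "0 < x" "x < N 1" | "N 1 \<le> x" "x \<le> K" | "K < x" by linarith
    then show ?thesis
    proof cases
      case 1
      then show ?thesis using no[of q] A[of 2] e2 f N1 N2 by simp
    next
      case 2
      have "e x = -1" using A[of x] 2 x f e_l by (simp add: f_def)
      then have "x \<le> l" using l_max 2 by simp
      moreover have "\<not> x < l"
      proof
        assume "x < l"
        moreover have "e (q + l) = -1" using A[of l] l l2 N2 by simp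
        moreover have "l < q + l - n" "q + l - n \<le> K" "n + (q + l - n) = q + l"
          using f l K3 l2 \<open>x < l\<close> by (auto simp: f_def)
        ultimately show False using e_pm[of "q + l - n"] by simp
      qed
      ultimately have "n = q" using f by (simp add: f_def)
      then show ?thesis using q_dvd by (simp add: two)
    next
      case 3
      then have "e (q + x) = 1" using A[of x] x ones[of x] N1 by simp
      then show ?thesis using e_l f by (simp add: f_def)
    next
      case 4
      then show ?thesis using no[of "q + N 2"] at_end f x N2 by simp
    qed
  next
    assume B: "\<forall>t. 0 < t \<and> t < N (Suc 1) \<longrightarrow>
      e (q + t) = (if N 1 dvd t then (- 1) ^ 1 else e (t mod N 1))"
    \<comment> \<open>\<open>g\<close> is \<open>x\<close> rounded up to a multiple of
      \<open>N 1\<close>. A lap or a new block starts there, with a \<open>-1\<close> two steps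
      later.\<close>
    define g where "g = (x + (N 1 - 1)) div N 1 * N 1"
    have g_dvd: "N 1 dvd g" by (simp add: g_def)
    have g: "x \<le> g" "g < x + N 1"
    proof -
      have "x + (N 1 - 1) = g + (x + (N 1 - 1)) mod N 1"
        unfolding g_def by (rule div_mult_mod_eq[symmetric])
      moreover have "(x + (N 1 - 1)) mod N 1 < N 1" using N1 by simp
      ultimately show "x \<le> g" "g < x + N 1" using N1 by linarith+
    qed
    have "g \<le> N 2"
    proof (rule ccontr)
      assume "\<not> g \<le> N 2"
      then have "N 2 + N 1 \<le> g" using multiple_gap[OF N12 g_dvd] by simp
      then show False using g x by simp
    qed
    have "e (q + g + 2) = -1"
    proof (cases "g = N 2")
      case True
      then show ?thesis using at_end by simp
    next
      case False
      then have "g + N 1 \<le> N 2" using multiple_gap[OF g_dvd N12] \<open>g \<le> N 2\<close> by simp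
      moreover have "(g + 2) mod N 1 = 2 mod N 1"
        using g_dvd by (metis mod_add_left_eq add_0 dvd_eq_mod_eq_0)
      then have "(g + 2) mod N 1 = 2" using N1 by simp
      moreover from this have "\<not> N 1 dvd g + 2" by (simp add: dvd_eq_mod_eq_0)
      ultimately show ?thesis
        using B[rule_format, of "g + 2"] N1 e2 by (simp add: two add.assoc)
    qed
    then show ?thesis using no[of "q + g"] g f by simp
  qed simp
qed

text \<open>The induction hypothesis fixes the phase modulo \<open>N (Suc i)\<close>. Among the
  phases modulo \<open>N (Suc (Suc i))\<close> that remain, the symbols at \<open>n + u\<close>,
  \<open>n + v\<close> and \<open>n + v + u\<close> single out the start of a block.\<close>

lemma prefix_recognition:
  assumes "0 < i"
  shows "\<exists>L. \<forall>n. (\<forall>t. 0 < t \<and> t \<le> L \<longrightarrow> e (n + t) = e t) \<longrightarrow> N (Suc i) dvd n"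
  using assms
proof (induction i rule: nat_induct_non_zero)
  case 1
  have "N (Suc 1) dvd n" if "\<forall>t. 0 < t \<and> t \<le> N 1 + 2 * r 0 * N 1 \<longrightarrow> e (n + t) = e t" for n
    using prefix_recognition_base[of n] that by (simp add: numeral_2_eq_2)
  then show ?case by blast
next
  case (Suc i)
  then obtain L where L: "\<And>n. (\<forall>t. 0 < t \<and> t \<le> L \<longrightarrow> e (n + t) = e t) \<Longrightarrow> N (Suc i) dvd n"
    by blast
  define u v w where "u = N i" and "v = N (Suc i)" and "w = N (Suc (Suc i))"
  define M where "M = r i * v"
  have w: "w = 2 * v + M * u" using N_Suc_Suc[of i] by (simp add: u_def v_def w_def M_def)
  have uv: "1 < u" "u < v" using N_gt_1 N_less_Suc by (auto simp: u_def v_def)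
  have u_dvd: "u dvd v" using N_dvd_Suc Suc.hyps by (simp add: u_def v_def)
  have v_dvd: "v dvd w" using N_dvd_Suc[of "Suc i"] by (simp add: w_def v_def)
  have "N (Suc (Suc i)) dvd n"
    if n: "\<forall>t. 0 < t \<and> t \<le> L + 2 * v \<longrightarrow> e (n + t) = e t" for n
  proof -
    have n_dvd: "v dvd n" using L[of n] n by (simp add: v_def)
    have e_u: "e u = - ((- 1) ^ i)" using e_N[of i] by (simp add: u_def)
    have e_v: "e v = (- 1) ^ i" using e_N[of "Suc i"] by (simp add: v_def)
    have e_vu: "e (v + u) = (- 1) ^ i"
      using e_pole[of 1 i] r_pos[of i] uv by (simp add: v_def u_def Suc_le_eq)
    have n_u: "e (n + u) = - ((- 1) ^ i)" using n e_u uv by simp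
    have n_v: "e (n + v) = (- 1) ^ i" using n e_v uv by simp
    have n_vu: "e (n + v + u) = (- 1) ^ i" using n e_vu uv by (simp add: add.assoc)
    define q where "q = n div w * w"
    define s where "s = n mod w"
    have nqs: "n = q + s" by (simp add: q_def s_def)
    have s_less: "s < w" using w uv by (simp add: s_def)
    have s_dvd: "v dvd s" using n_dvd v_dvd by (simp add: s_def dvd_mod)
    have q_dvd: "N (Suc (Suc i)) dvd q" by (simp add: q_def w_def)
    have next_block: False if "s + v = w"
    proof -
      have "n + v = q + w" using nqs that by simp
      moreover have "e (q + w + u) = e u"
        using block_starts_like_prefix[of "Suc i" "q + w" u] q_dvd uv by (simp add: w_def v_def)
      ultimately show False using n_vu e_u by simp
    qed
    have "s = 0"
    proof (rule ccontr)
      assume "s \<noteq> 0"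
      then have v_le: "v \<le> s" using s_dvd by (simp add: dvd_imp_le)
      have "s + v \<le> w" using multiple_gap[OF s_dvd v_dvd s_less] .
      with next_block have sv: "s + v < w" by force
      show False
        using block_types[OF _ q_dvd]
      proof
        \<comment> \<open>Here \<open>n + u\<close> is a pole in the run of laps, where the symbol
          is opposite to \<open>e u\<close>.\<close>
        assume A: "\<forall>t. 0 < t \<and> t < N (Suc (Suc i)) \<longrightarrow> e (q + t) = e t"
        have "v dvd v + M * u" by (simp add: M_def)
        moreover have "v dvd w" by fact
        moreover have "s + v < v + M * u + v" using sv w by simp
        ultimately have s_le: "s + v \<le> v + M * u"
          using multiple_gap[of v s "v + M * u"] s_dvd by simp
        then have "s - v + v \<le> M * u" using v_le by simp
        then have less: "s - v + u < M * u" using uv by linarith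
        have "u dvd s - v + u" using s_dvd u_dvd v_le by (meson dvd_add dvd_diff_nat dvd_refl dvd_trans)
        then obtain j where j: "s - v + u = j * u" by (metis dvd_div_mult_self)
        with less have "j < M" by simp
        moreover have "s + u = v + j * u" using j v_le by simp
        ultimately have "e (s + u) = (- 1) ^ i"
          using e_pole[of j i] by (simp add: v_def u_def M_def)
        moreover have "e (q + (s + u)) = e (s + u)"
          using A sv uv by (simp add: w_def)
        ultimately show False using n_u nqs by (simp add: add.assoc)
      next
        \<comment> \<open>Here \<open>n + v\<close> is a pole of the next level, where the symbol is
          opposite to \<open>e v\<close>.\<close>
        assume B: "\<forall>t. 0 < t \<and> t < N (Suc (Suc i)) \<longrightarrow>
          e (q + t) = (if N (Suc i) dvd t then (- 1) ^ Suc i else e (t mod N (Suc i)))"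
        then have "e (q + (s + v)) = - ((- 1) ^ i)" using sv s_dvd uv by (simp add: w_def v_def)
        then show False using n_v nqs by (simp add: add.assoc)
      qed simp
    qed
    then show ?thesis using nqs q_dvd by simp
  qed
  then show ?case by blast
qed

text \<open>
  Two phase-equal positions can only carry different symbols at multiples of \<open>N i\<close> or ahead of a
  second discrepancy, which happens at a fixed phase.
\<close>

lemma second_discrepancy:
  assumes i: "0 < i" and cong: "n mod N (Suc i) = m mod N (Suc i)"
    and "\<not> N i dvd n" "e n \<noteq> e m"
  obtains k where "0 < k" "k < N (Suc i)" "e (n + k) \<noteq> e (m + k)" "\<not> N (Suc i) dvd n + k"
proof -
  note result = that
  define w where "w = N (Suc i)"
  obtain j where j: "i = Suc j" using i by (cases i) auto
  \<comment> \<open>\<open>K\<close> is the last pole in the prefix of length \<open>w\<close>; the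
    return of length \<open>N i\<close> starts there.\<close>
  define K where "K = N i + r j * N i * N j"
  have w: "w = K + N i" using N_Suc_Suc[of j] j by (simp add: w_def K_def)
  define s where "s = n mod w"
  define q where "q = n div w * w"
  define p where "p = m div w * w"
  have nq: "n = q + s" by (simp add: q_def s_def)
  have mp: "m = p + s" using cong by (simp add: p_def s_def w_def)
  have s_less: "s < w" using N_gt_1[of "Suc i"] by (simp add: s_def w_def)
  have q_dvd: "N (Suc i) dvd q" and p_dvd: "N (Suc i) dvd p" by (auto simp: q_def p_def w_def)
  have N_dvd_w: "N i dvd w" using N_dvd_Suc[OF i] by (simp add: w_def)
  have s_dvd: "\<not> N i dvd s"
  proof
    assume "N i dvd s"
    moreover have "N i dvd q" using q_dvd N_dvd_w dvd_trans by (auto simp: w_def)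
    ultimately show False using assms nq by simp
  qed
  have s_pos: "0 < s" using s_dvd by (cases s) auto
  have K_dvd: "N i dvd K" by (simp add: K_def)
  have K_pos: "0 < K" "K < w" using N_gt_1[of i] w by (auto simp: K_def)
  have e_K: "e K = (- 1) ^ j" using e_pole[of "r j * N (Suc j)" j] j by (simp add: K_def)
  have e_Kt: "e (K + t) = e t" if "0 < t" "t < N i" for t
    using e_return[of t j] that j by (simp add: K_def)
  define A where "A b \<longleftrightarrow> (\<forall>t. 0 < t \<and> t < w \<longrightarrow> e (b + t) = e t)" for b
  define B where "B b \<longleftrightarrow> (\<forall>t. 0 < t \<and> t < w \<longrightarrow>
    e (b + t) = (if N i dvd t then (- 1) ^ i else e (t mod N i)))" for b
  \<comment> \<open>Different symbols require one block of each type. After \<open>K\<close> both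
    types replay the same prefix, so the given discrepancy lies before \<open>K\<close>; at
    \<open>K\<close> itself the types carry opposite symbols, which is the second
    discrepancy.\<close>
  have main: thesis if AB: "A b" "B c" and bc: "(b = q \<and> c = p) \<or> (b = p \<and> c = q)" for b c
  proof -
    have neq: "e (b + s) \<noteq> e (c + s)" using bc assms nq mp by auto
    have "s < K"
    proof (rule ccontr)
      assume "\<not> s < K"
      moreover have "s \<noteq> K" using s_dvd K_dvd by auto
      ultimately have "K < s" by simp
      then have t: "0 < s - K" "s - K < N i" using s_less w by auto
      have "s mod N i = (s - K) mod N i"
        using K_dvd \<open>K < s\<close> by (metis le_add_diff_inverse less_imp_le mod_add_left_eq add_0 dvd_eq_mod_eq_0)
      then have "s mod N i = s - K" using t by simp
      moreover have "e s = e (s - K)" using e_Kt[OF t] \<open>K < s\<close> by simp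
      ultimately show False using AB neq s_dvd s_pos s_less by (auto simp: A_def B_def)
    qed
    moreover have "e (b + K) = (- 1) ^ j" using AB(1) K_pos e_K by (simp add: A_def)
    moreover have "e (c + K) = - ((- 1) ^ j)" using AB(2) K_pos K_dvd j by (simp add: B_def)
    ultimately have ne: "e (b + s + (K - s)) \<noteq> e (c + s + (K - s))" by simp
    have "\<not> N (Suc i) dvd K" using K_pos by (simp add: w_def nat_dvd_not_less)
    then have nd: "\<not> N (Suc i) dvd q + K" using q_dvd by (simp add: dvd_add_right_iff)
    show thesis
    proof (rule result)
      show "0 < K - s" "K - s < N (Suc i)" using \<open>s < K\<close> K_pos by (auto simp: w_def)
      show "e (n + (K - s)) \<noteq> e (m + (K - s))" using ne bc nq mp by auto
      show "\<not> N (Suc i) dvd n + (K - s)" using nd nq \<open>s < K\<close> by simp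
    qed
  qed
  have "A q \<or> B q" "A p \<or> B p"
    using block_types[OF i q_dvd] block_types[OF i p_dvd] by (auto simp: A_def B_def w_def)
  moreover have "e (q + s) \<noteq> e (p + s)" using assms nq mp by simp
  then have "\<not> (A q \<and> A p)" "\<not> (B q \<and> B p)"
    unfolding A_def B_def using s_pos s_less by metis+
  ultimately show thesis using main by blast
qed

end

section \<open>The tent map in normal form\<close>

text \<open>For \<open>a > 1\<close> this is the tent map conjugated by
  \<open>z \<mapsto> 1 / 2 + (a - 1) / 2 * z\<close>, which moves the turning point to
  \<open>0\<close> and its image to \<open>1\<close>.\<close>

definition normal_tent :: "real \<Rightarrow> real \<Rightarrow> real" where
  "normal_tent a z = 1 - a * \<bar>z\<bar>"

definition crit :: "real \<Rightarrow> nat \<Rightarrow> real" where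
  "crit a n = (normal_tent a ^^ n) 0"

lemma crit_0 [simp]: "crit a 0 = 0"
  by (simp add: crit_def)

lemma crit_Suc: "crit a (Suc n) = 1 - a * \<bar>crit a n\<bar>"
  by (simp add: crit_def normal_tent_def)

lemma crit_1 [simp]: "crit a (Suc 0) = 1"
  by (simp add: crit_Suc)

lemma crit_2: "crit a 2 = 1 - a"
  by (simp add: crit_Suc numeral_2_eq_2)

lemma crit_add: "crit a (n + t) = (normal_tent a ^^ t) (crit a n)"
  by (simp add: crit_def add.commute[of n] funpow_add)

lemma normal_tent_iter_Suc: "(normal_tent a ^^ Suc n) x = 1 - a * \<bar>(normal_tent a ^^ n) x\<bar>"
  by (simp add: normal_tent_def)

lemma abs_crit_le_1:
  assumes "0 \<le> a" "a \<le> 2"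
  shows "\<bar>crit a n\<bar> \<le> 1"
proof (induction n)
  case (Suc n)
  have "a * \<bar>crit a n\<bar> \<le> 2 * 1" using assms Suc by (intro mult_mono) auto
  moreover have "0 \<le> a * \<bar>crit a n\<bar>" using assms by simp
  ultimately show ?case by (simp add: crit_Suc abs_le_iff)
qed simp

lemma continuous_on_crit: "continuous_on A (\<lambda>a. crit a n)"
  by (induction n) (auto simp: crit_Suc intro!: continuous_intros)

lemma normal_tent_iter_lipschitz:
  assumes "0 \<le> a" "a \<le> 2"
  shows "\<bar>(normal_tent a ^^ t) x - (normal_tent a ^^ t) y\<bar> \<le> 2 ^ t * \<bar>x - y\<bar>"
proof (induction t)
  case (Suc t)
  let ?x = "(normal_tent a ^^ t) x" and ?y = "(normal_tent a ^^ t) y"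
  have "\<bar>(normal_tent a ^^ Suc t) x - (normal_tent a ^^ Suc t) y\<bar> = a * \<bar>\<bar>?y\<bar> - \<bar>?x\<bar>\<bar>"
    using assms unfolding normal_tent_iter_Suc by (simp add: abs_mult flip: right_diff_distrib)
  also have "\<dots> \<le> 2 * \<bar>?x - ?y\<bar>" using assms by (intro mult_mono) auto
  also have "\<dots> \<le> 2 * (2 ^ t * \<bar>x - y\<bar>)" using Suc by simp
  finally show ?case by simp
qed simp

text \<open>Points of equal sign lie on one branch, so each step multiplies their distance by
  \<open>a\<close>. The first step may fold, hence the inner absolute values.\<close>

lemma normal_tent_iter_expand:
  assumes "0 \<le> a" "\<And>t. 0 < t \<Longrightarrow> t \<le> n \<Longrightarrow> sgn ((normal_tent a ^^ t) x) = sgn ((normal_tent a ^^ t) y)"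
  shows "\<bar>(normal_tent a ^^ Suc n) x - (normal_tent a ^^ Suc n) y\<bar> = a ^ Suc n * \<bar>\<bar>x\<bar> - \<bar>y\<bar>\<bar>"
  using assms(2)
proof (induction n)
  case 0
  show ?case using assms(1) by (simp add: normal_tent_def abs_mult abs_minus_commute flip: right_diff_distrib)
next
  case (Suc n)
  let ?x = "(normal_tent a ^^ Suc n) x" and ?y = "(normal_tent a ^^ Suc n) y"
  have "sgn ?x = sgn ?y" using Suc.prems by blast
  then have eq: "\<bar>\<bar>?y\<bar> - \<bar>?x\<bar>\<bar> = \<bar>?x - ?y\<bar>" by (auto simp: sgn_real_def split: if_splits)
  have "\<bar>(normal_tent a ^^ Suc (Suc n)) x - (normal_tent a ^^ Suc (Suc n)) y\<bar> = a * \<bar>\<bar>?y\<bar> - \<bar>?x\<bar>\<bar>"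
    using assms(1) unfolding normal_tent_iter_Suc[where n = "Suc n"]
    by (simp add: abs_mult flip: right_diff_distrib del: funpow.simps)
  also have "\<dots> = a * (a ^ Suc n * \<bar>\<bar>x\<bar> - \<bar>y\<bar>\<bar>)" unfolding eq using Suc by simp
  finally show ?case by simp
qed

section \<open>Injectivity on the critical orbit closure\<close>

locale renorm_tent = renorm_word N r "\<lambda>n. sgn (crit a n)" for N r :: "nat \<Rightarrow> nat" and a :: real +
  assumes a_gt_1: "1 < a" and a_le_2: "a \<le> 2"
    and crit_nonzero: "0 < n \<Longrightarrow> crit a n \<noteq> 0"
begin

text \<open>From time \<open>m\<close> the orbit shadows itself for \<open>N i\<close> steps. The
  distance to the turning point is multiplied by \<open>a ^ N i\<close> meanwhile, but two orbit
  points are at most \<open>2\<close> apart.\<close>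

lemma crit_multiple_small:
  assumes "0 < i" "N (Suc i) dvd m"
  shows "\<bar>crit a m\<bar> \<le> 2 / a ^ N i"
proof -
  obtain n where n: "N i = Suc n" using N_gt_1[of i] by (cases "N i") auto
  have "\<bar>crit a (m + N i) - crit a (N i)\<bar> = a ^ N i * \<bar>\<bar>crit a m\<bar> - \<bar>0\<bar>\<bar>"
    unfolding n crit_add unfolding crit_def
  proof (rule normal_tent_iter_expand)
    fix t assume "0 < t" "t \<le> n"
    then show "sgn ((normal_tent a ^^ t) ((normal_tent a ^^ m) 0)) = sgn ((normal_tent a ^^ t) 0)"
      using block_starts_like_prefix[OF assms, of t] n by (simp add: crit_add flip: crit_def)
  qed (use a_gt_1 in simp)
  moreover have "\<bar>crit a (m + N i) - crit a (N i)\<bar> \<le> 2"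
    using abs_crit_le_1[of a "m + N i"] abs_crit_le_1[of a "N i"] a_gt_1 a_le_2 by linarith
  ultimately show ?thesis using a_gt_1 by (simp add: field_simps)
qed

lemma crit_multiple_arbitrarily_small:
  assumes "0 < \<epsilon>"
  obtains i where "0 < i" "\<And>m. N (Suc i) dvd m \<Longrightarrow> \<bar>crit a m\<bar> < \<epsilon>"
proof -
  obtain k where k: "2 / \<epsilon> < a ^ k" using real_arch_pow[OF a_gt_1] by blast
  have "Suc k \<le> N (Suc k)" using strict_mono_N by (rule strict_mono_imp_increasing)
  then have "a ^ k \<le> a ^ N (Suc k)" using a_gt_1 by (intro power_increasing) auto
  with k have "2 / \<epsilon> < a ^ N (Suc k)" by simp
  then have "2 / a ^ N (Suc k) < \<epsilon>" using assms a_gt_1 by (simp add: field_simps)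
  then show ?thesis using that[of "Suc k"] crit_multiple_small[of "Suc k"] by fastforce
qed

text \<open>The signs at positive times are stable under small changes of the starting point, since
  the values are nonzero and the iterates are Lipschitz.\<close>

lemma crit_prefix:
  "\<exists>\<rho>>0. \<forall>n. \<bar>crit a n\<bar> < \<rho> \<longrightarrow> (\<forall>t. 0 < t \<and> t \<le> L \<longrightarrow> sgn (crit a (n + t)) = sgn (crit a t))"
proof (induction L)
  case (Suc L)
  then obtain \<rho> where \<rho>: "0 < \<rho>"
    "\<And>n t. \<bar>crit a n\<bar> < \<rho> \<Longrightarrow> 0 < t \<Longrightarrow> t \<le> L \<Longrightarrow> sgn (crit a (n + t)) = sgn (crit a t)" by blast
  define \<sigma> where "\<sigma> = \<bar>crit a (Suc L)\<bar> / 2 ^ Suc L"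
  have "0 < \<sigma>" using crit_nonzero by (simp add: \<sigma>_def)
  have step: "sgn (crit a (n + Suc L)) = sgn (crit a (Suc L))" if "\<bar>crit a n\<bar> < \<sigma>" for n
  proof -
    have "\<bar>crit a (n + Suc L) - crit a (0 + Suc L)\<bar> \<le> 2 ^ Suc L * \<bar>crit a n - crit a 0\<bar>"
      unfolding crit_add using a_gt_1 a_le_2 by (intro normal_tent_iter_lipschitz) auto
    also have "\<dots> < 2 ^ Suc L * \<sigma>" using that by simp
    also have "\<dots> = \<bar>crit a (Suc L)\<bar>" by (simp add: \<sigma>_def)
    finally show ?thesis by (auto simp: sgn_real_def split: if_splits)
  qed
  show ?case
  proof (intro exI[of _ "min \<rho> \<sigma>"] conjI allI impI)
    fix n t assume "\<bar>crit a n\<bar> < min \<rho> \<sigma>" "0 < t \<and> t \<le> Suc L"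
    then show "sgn (crit a (n + t)) = sgn (crit a t)"
      using \<rho>(2)[of n t] step[of n] by (cases "t = Suc L") auto
  qed (use \<rho> \<open>0 < \<sigma>\<close> in auto)
qed (auto intro: exI[of _ 1])

text \<open>Converse to \<open>crit_multiple_small\<close>: closeness to the turning point forces
  shadowing of a long prefix, and \<open>prefix_recognition\<close> reads the phase off it.\<close>

lemma crit_return_times:
  assumes "0 < i"
  obtains \<rho> where "0 < \<rho>" "\<And>n. \<bar>crit a n\<bar> < \<rho> \<Longrightarrow> N (Suc i) dvd n"
proof -
  obtain L where L: "\<And>n. (\<forall>t. 0 < t \<and> t \<le> L \<longrightarrow> sgn (crit a (n + t)) = sgn (crit a t)) \<Longrightarrow> N (Suc i) dvd n"
    using prefix_recognition[OF assms] by blast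
  obtain \<rho> where "0 < \<rho>"
    "\<And>n. \<bar>crit a n\<bar> < \<rho> \<longrightarrow> (\<forall>t. 0 < t \<and> t \<le> L \<longrightarrow> sgn (crit a (n + t)) = sgn (crit a t))"
    using crit_prefix by blast
  then show thesis using that[of \<rho>] L by blast
qed

text \<open>Orbit points near \<open>x\<close> and near \<open>-x\<close> have a common future,
  hence equal phases. Their different signs then give a second discrepancy, which would be a close
  return at a forbidden phase.\<close>

lemma crit_no_symmetric_limits:
  assumes x: "\<And>\<epsilon>. 0 < \<epsilon> \<Longrightarrow> \<exists>n>0. \<bar>crit a n - x\<bar> < \<epsilon>"
    and y: "\<And>\<epsilon>. 0 < \<epsilon> \<Longrightarrow> \<exists>n>0. \<bar>crit a n + x\<bar> < \<epsilon>"
  shows "x = 0"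
proof (rule ccontr)
  assume "x \<noteq> 0"
  then obtain i' where i': "0 < i'" "\<And>m. N (Suc i') dvd m \<Longrightarrow> \<bar>crit a m\<bar> < \<bar>x\<bar> / 2"
    using crit_multiple_arbitrarily_small[of "\<bar>x\<bar> / 2"] by auto
  \<comment> \<open>After this shift the orbit is within \<open>\<bar>x\<bar> / 2\<close> of
    \<open>0\<close> at all multiples of \<open>N i\<close>, so a time at which it is near
    \<open>x\<close> is not such a multiple.\<close>
  define i where "i = Suc i'"
  have i: "0 < i" "\<And>m. N i dvd m \<Longrightarrow> \<bar>crit a m\<bar> < \<bar>x\<bar> / 2" using i' by (auto simp: i_def)
  obtain \<rho> where \<rho>: "0 < \<rho>" "\<And>n. \<bar>crit a n\<bar> < \<rho> \<Longrightarrow> N (Suc i) dvd n"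
    using crit_return_times[OF i(1)] by blast
  obtain j where j: "0 < j" "\<And>m. N (Suc j) dvd m \<Longrightarrow> \<bar>crit a m\<bar> < \<rho> / 2"
    using crit_multiple_arbitrarily_small[of "\<rho> / 2"] \<rho> by auto
  define U where "U = N (Suc i) + N (Suc j)"
  \<comment> \<open>The first bound keeps the approximants on the sides of \<open>x\<close> and
    \<open>-x\<close>; the second keeps their orbits within \<open>\<rho> / 2\<close> of each other
    for \<open>U\<close> steps.\<close>
  define \<eta> where "\<eta> = min (\<bar>x\<bar> / 2) (\<rho> / (4 * 2 ^ U))"
  have "\<eta> \<le> \<rho> / (4 * 2 ^ U)" by (simp add: \<eta>_def)
  then have \<eta>: "0 < \<eta>" "\<eta> \<le> \<bar>x\<bar> / 2" "4 * 2 ^ U * \<eta> \<le> \<rho>"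
    using \<rho>(1) \<open>x \<noteq> 0\<close> by (auto simp: \<eta>_def le_divide_eq mult.commute)
  obtain n where n: "0 < n" "\<bar>crit a n - x\<bar> < \<eta>" using x \<eta> by blast
  obtain m where m: "0 < m" "\<bar>crit a m + x\<bar> < \<eta>" using y \<eta> by blast
  have sgn_neq: "sgn (crit a n) \<noteq> sgn (crit a m)"
    using n m \<eta> by (auto simp: sgn_real_def split: if_splits)
  have ndvd: "\<not> N i dvd n"
    using i(2)[of n] n \<eta> by auto
  have near: "\<bar>crit a (n + t) - crit a (m + t)\<bar> < \<rho> / 2" if t: "0 < t" "t \<le> U" for t
  proof -
    obtain t' where t': "t = Suc t'" using t by (cases t) auto
    have "\<bar>crit a (Suc n) - crit a (Suc m)\<bar> = a * \<bar>\<bar>crit a m\<bar> - \<bar>crit a n\<bar>\<bar>"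
      using a_gt_1 by (simp add: crit_Suc abs_mult flip: right_diff_distrib)
    also have "\<dots> < 2 * (2 * \<eta>)"
      using n m a_gt_1 a_le_2 by (intro mult_le_less_imp_less) auto
    finally have 1: "\<bar>crit a (Suc n) - crit a (Suc m)\<bar> < 4 * \<eta>" by simp
    have "\<bar>crit a (Suc n + t') - crit a (Suc m + t')\<bar> \<le> 2 ^ t' * \<bar>crit a (Suc n) - crit a (Suc m)\<bar>"
      unfolding crit_add using a_gt_1 a_le_2 by (intro normal_tent_iter_lipschitz) auto
    also have "\<dots> < 2 ^ t' * (4 * \<eta>)" using 1 by simp
    also have "\<dots> = 2 ^ t * (2 * \<eta>)" by (simp add: t')
    also have "\<dots> \<le> 2 ^ U * (2 * \<eta>)" using t \<eta> by (intro mult_right_mono power_increasing) auto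
    also have "\<dots> \<le> \<rho> / 2" using \<eta> by simp
    finally show ?thesis by (simp add: t')
  qed
  \<comment> \<open>\<open>n + u\<close> is the next multiple of \<open>N (Suc j)\<close>. There
    both orbits are within \<open>\<rho>\<close> of \<open>0\<close>, so both times are multiples of
    \<open>N (Suc i)\<close>.\<close>
  define u where "u = N (Suc j) - n mod N (Suc j)"
  have Nj: "n mod N (Suc j) < N (Suc j)" using N_gt_1[of "Suc j"] by simp
  have "n + u = n div N (Suc j) * N (Suc j) + N (Suc j)"
    using Nj div_mult_mod_eq[of n "N (Suc j)"] unfolding u_def by linarith
  then have "N (Suc j) dvd n + u" by simp
  then have small: "\<bar>crit a (n + u)\<bar> < \<rho> / 2" by (rule j)
  have u: "0 < u" "u \<le> U" using Nj by (auto simp: u_def U_def)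
  have "N (Suc i) dvd n + u" using \<rho>(2)[of "n + u"] small \<rho>(1) by simp
  moreover have "N (Suc i) dvd m + u" using \<rho>(2)[of "m + u"] small near[OF u] by linarith
  ultimately have "N (Suc i) dvd n + u - (m + u)" "N (Suc i) dvd m + u - (n + u)"
    by (blast intro: dvd_diff_nat)+
  then have "N (Suc i) dvd n - m" "N (Suc i) dvd m - n" by simp_all
  then have cong: "n mod N (Suc i) = m mod N (Suc i)"
    by (metis mod_eq_dvd_iff_nat nle_le)
  obtain k where k: "0 < k" "k < N (Suc i)" "sgn (crit a (n + k)) \<noteq> sgn (crit a (m + k))"
    "\<not> N (Suc i) dvd n + k"
    using second_discrepancy[OF i(1) cong ndvd sgn_neq] by blast
  have "\<bar>crit a (n + k) - crit a (m + k)\<bar> < \<rho> / 2" using near[of k] k by (simp add: U_def)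
  \<comment> \<open>Two close values of different sign are both close to \<open>0\<close>.\<close>
  then have "\<bar>crit a (n + k)\<bar> < \<rho>" using k(3) crit_nonzero[of "n + k"] crit_nonzero[of "m + k"] k(1)
    by (auto simp: sgn_real_def split: if_splits)
  then show False using \<rho>(2) k(4) by blast
qed

end

section \<open>Parameter windows\<close>

text \<open>The first point of value \<open>1\<close> and the last zero before it enclose a piece
  with all values between \<open>0\<close> and \<open>1\<close>. The descending case follows by
  passing to \<open>1 - h\<close>.\<close>

lemma crossing_subinterval:
  fixes h :: "real \<Rightarrow> real"
  assumes "l \<le> u" "continuous_on {l..u} h" "h l \<le> 0 \<and> 1 \<le> h u \<or> 1 \<le> h l \<and> h u \<le> 0"
  obtains l' u' where "l \<le> l'" "l' < u'" "u' \<le> u" "\<And>x. x \<in> {l'..u'} \<Longrightarrow> 0 \<le> h x \<and> h x \<le> 1"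
    "h l' = 0 \<and> h u' = 1 \<or> h l' = 1 \<and> h u' = 0"
proof -
  have up: "\<exists>l' u'. l \<le> l' \<and> l' < u' \<and> u' \<le> u \<and> (\<forall>x\<in>{l'..u'}. 0 \<le> k x \<and> k x \<le> 1) \<and> k l' = 0 \<and> k u' = 1"
    if cont: "continuous_on {l..u} k" and k: "k l \<le> 0" "1 \<le> k u" for k :: "real \<Rightarrow> real"
  proof -
    define S where "S = {x \<in> {l..u}. k x = 1}"
    have "closed S" unfolding S_def by (intro continuous_closed_preimage_constant cont) simp
    moreover have "bounded S" by (rule bounded_subset[of "{l..u}"]) (auto simp: S_def)
    ultimately have "compact S" by (simp add: compact_eq_bounded_closed)
    moreover have "S \<noteq> {}" using IVT'[of k l 1 u] k assms(1) cont by (auto simp: S_def)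
    ultimately obtain u' where u': "u' \<in> S" "\<And>x. x \<in> S \<Longrightarrow> u' \<le> x"
      using compact_attains_inf[of S] by blast
    have u'_in: "l \<le> u'" "u' \<le> u" "k u' = 1" using u' by (auto simp: S_def)
    have cont': "continuous_on {l..u'} k" using cont u'_in by (auto intro: continuous_on_subset)
    have le1: "k x \<le> 1" if x_in: "x \<in> {l..u'}" for x
    proof (rule ccontr)
      assume "\<not> k x \<le> 1"
      moreover have "continuous_on {l..x} k"
        by (rule continuous_on_subset[OF cont']) (use x_in in auto)
      ultimately obtain y where "l \<le> y" "y \<le> x" "k y = 1"
        using IVT'[of k l 1 x] k x_in by auto
      then have "u' \<le> y" using u'(2)[of y] x_in u'_in by (auto simp: S_def)
      then have "y = x" using x_in \<open>y \<le> x\<close> by simp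
      then show False using \<open>k y = 1\<close> \<open>\<not> k x \<le> 1\<close> by simp
    qed
    define Z where "Z = {x \<in> {l..u'}. k x = 0}"
    have "closed Z" unfolding Z_def by (intro continuous_closed_preimage_constant cont') simp
    moreover have "bounded Z" by (rule bounded_subset[of "{l..u'}"]) (auto simp: Z_def)
    ultimately have "compact Z" by (simp add: compact_eq_bounded_closed)
    moreover have "Z \<noteq> {}" using IVT'[of k l 0 u'] k u'_in cont' by (auto simp: Z_def)
    ultimately obtain l' where l': "l' \<in> Z" "\<And>x. x \<in> Z \<Longrightarrow> x \<le> l'"
      using compact_attains_sup[of Z] by blast
    have l'_in: "l \<le> l'" "l' \<le> u'" "k l' = 0" using l' by (auto simp: Z_def)
    have ge0: "0 \<le> k x" if x_in: "x \<in> {l'..u'}" for x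
    proof (rule ccontr)
      assume "\<not> 0 \<le> k x"
      moreover have "continuous_on {x..u'} k"
        by (rule continuous_on_subset[OF cont']) (use x_in l'_in in auto)
      ultimately obtain y where "x \<le> y" "y \<le> u'" "k y = 0"
        using IVT'[of k x 0 u'] x_in u'_in by auto
      then have "y \<le> l'" using l'(2)[of y] x_in l'_in by (auto simp: Z_def)
      then have "y = x" using x_in \<open>x \<le> y\<close> by simp
      then show False using \<open>k y = 0\<close> \<open>\<not> 0 \<le> k x\<close> by simp
    qed
    have "l' \<noteq> u'" using l'_in u'_in by auto
    then show ?thesis using l'_in u'_in le1 ge0
      by (intro exI[of _ l'] exI[of _ u']) auto
  qed
  show thesis
    using assms(3)
  proof
    assume "h l \<le> 0 \<and> 1 \<le> h u"
    then show thesis using up[OF assms(2)] that by blast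
  next
    assume "1 \<le> h l \<and> h u \<le> 0"
    moreover have "continuous_on {l..u} (\<lambda>x. 1 - h x)" by (intro continuous_intros assms(2))
    ultimately obtain l' u' where "l \<le> l'" "l' < u'" "u' \<le> u" "\<forall>x\<in>{l'..u'}. 0 \<le> 1 - h x \<and> 1 - h x \<le> 1"
      "1 - h l' = 0" "1 - h u' = 1"
      using up[of "\<lambda>x. 1 - h x"] by auto
    then show thesis using that[of l' u'] by auto
  qed
qed

text \<open>
  The distance from \<open>0\<close> to the orientation preserving fixed point of the \<open>d\<close>-th iterate on the
  central branch.
\<close>

definition pole :: "real \<Rightarrow> nat \<Rightarrow> real" where
  "pole a d = \<bar>crit a d\<bar> / (a ^ d - 1)"

text \<open>This describes the central branch of the \<open>d\<close>-th iterate up to the pole: one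
  itinerary, and at \<open>0\<close> a minimum for \<open>s = 1\<close> or a maximum for
  \<open>s = - 1\<close>.\<close>

definition follows :: "real \<Rightarrow> nat \<Rightarrow> (nat \<Rightarrow> real) \<Rightarrow> real \<Rightarrow> bool" where
  "follows a d e s \<longleftrightarrow> (\<forall>x. \<bar>x\<bar> \<le> pole a d \<longrightarrow>
    (\<forall>t. 0 < t \<and> t < d \<longrightarrow> sgn ((normal_tent a ^^ t) x) = e t) \<and>
    (normal_tent a ^^ d) x = crit a d + s * a ^ d * \<bar>x\<bar>)"

text \<open>Each lap multiplies the distance to the pole by \<open>a ^ d\<close>. The points move
  monotonically away from it, so if the last one has not passed \<open>0\<close>, all of them lie on
  the same half of the central branch.\<close>

lemma follows_laps:
  fixes M :: nat
  assumes "follows a d e s" "s = 1 \<or> s = -1" "1 < a ^ d" "crit a d = - s * \<bar>crit a d\<bar>"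
    and v: "v \<le> pole a d" "0 \<le> pole a d - (a ^ d) ^ M * (pole a d - v)" and j: "j \<le> M"
  shows "(normal_tent a ^^ (j * d)) (s * v) = s * (pole a d - (a ^ d) ^ j * (pole a d - v))"
    and "pole a d - (a ^ d) ^ M * (pole a d - v) \<le> pole a d - (a ^ d) ^ j * (pole a d - v)"
    and "pole a d - (a ^ d) ^ j * (pole a d - v) \<le> pole a d"
    and "0 < t \<Longrightarrow> t < d \<Longrightarrow> sgn ((normal_tent a ^^ (j * d + t)) (s * v)) = e t"
proof -
  define P where "P = pole a d"
  define b where "b = a ^ d"
  define y where "y j = P - b ^ j * (P - v)" for j
  have b: "1 < b" using assms by (simp add: b_def)
  have y_Suc: "y (Suc j) = P - b * (P - y j)" for j by (simp add: y_def algebra_simps)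
  have y_le: "y j \<le> P" for j using b v by (simp add: y_def P_def)
  have y_mono: "y M \<le> y j" if "j \<le> M" for j
    unfolding y_def using b v that by (simp add: P_def mult_right_mono power_increasing)
  have y_nonneg: "0 \<le> y j" if "j \<le> M" for j using y_mono[OF that] v by (simp add: y_def P_def b_def)
  have abs_sy: "\<bar>s * y j\<bar> = y j" if "j \<le> M" for j using y_nonneg[OF that] assms(2) by auto
  have c: "crit a d = - s * ((b - 1) * P)" using assms(3,4) by (simp add: P_def pole_def b_def)
  have signs: "sgn ((normal_tent a ^^ t) (s * y j)) = e t" if "j \<le> M" "0 < t" "t < d" for j t
    using assms(1) that y_le[of j] abs_sy[OF that(1)] by (simp add: follows_def P_def)
  have next_y: "(normal_tent a ^^ d) (s * y j) = s * y (Suc j)" if "j \<le> M" for j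
  proof -
    have "(normal_tent a ^^ d) (s * y j) = crit a d + s * b * \<bar>s * y j\<bar>"
      using assms(1) y_le[of j] abs_sy[OF that] by (simp add: follows_def P_def b_def)
    also have "\<dots> = s * y (Suc j)" unfolding abs_sy[OF that] c y_Suc by (simp add: algebra_simps)
    finally show ?thesis .
  qed
  have iter: "(normal_tent a ^^ (j * d)) (s * v) = s * y j" if "j \<le> M" for j
    using that
  proof (induction j)
    case (Suc j)
    have "(normal_tent a ^^ (Suc j * d)) (s * v) = (normal_tent a ^^ d) ((normal_tent a ^^ (j * d)) (s * v))"
      by (simp add: funpow_add)
    then show ?case using Suc next_y[of j] by simp
  qed (simp add: y_def)
  show "(normal_tent a ^^ (j * d)) (s * v) = s * (pole a d - (a ^ d) ^ j * (pole a d - v))"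
    using iter[OF j] by (simp add: y_def P_def b_def)
  show "pole a d - (a ^ d) ^ M * (pole a d - v) \<le> pole a d - (a ^ d) ^ j * (pole a d - v)"
    using y_mono[OF j] by (simp add: y_def P_def b_def)
  show "pole a d - (a ^ d) ^ j * (pole a d - v) \<le> pole a d"
    using y_le[of j] by (simp add: y_def P_def b_def)
  show "sgn ((normal_tent a ^^ (j * d + t)) (s * v)) = e t" if "0 < t" "t < d"
  proof -
    have "(normal_tent a ^^ (j * d + t)) (s * v) = (normal_tent a ^^ t) ((normal_tent a ^^ (j * d)) (s * v))"
      by (simp add: funpow_add add.commute[of "j * d"])
    then show ?thesis using iter[OF j] signs[OF j that] by simp
  qed
qed

text \<open>The laps include the position \<open>N + M * d\<close>, so that the closing pole carries
  \<open>s\<close> instead of the unspecified symbol \<open>e 0\<close>.\<close>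

definition ext_word :: "nat \<Rightarrow> nat \<Rightarrow> nat \<Rightarrow> real \<Rightarrow> (nat \<Rightarrow> real) \<Rightarrow> nat \<Rightarrow> real" where
  "ext_word d N M s e t =
    (if t < N then e t
     else if t \<le> N + M * d then (if d dvd t - N then s else e ((t - N) mod d))
     else e (t - (N + M * d)))"

lemma ext_word_simps:
  assumes "0 < d" "d < N"
  shows "t < N \<Longrightarrow> ext_word d N M s e t = e t"
    and "j \<le> M \<Longrightarrow> ext_word d N M s e (N + j * d) = s"
    and "j < M \<Longrightarrow> 0 < t \<Longrightarrow> t < d \<Longrightarrow> ext_word d N M s e (N + j * d + t) = e t"
    and "0 < t \<Longrightarrow> ext_word d N M s e (N + M * d + t) = e t"
proof -
  show "j < M \<Longrightarrow> 0 < t \<Longrightarrow> t < d \<Longrightarrow> ext_word d N M s e (N + j * d + t) = e t"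
  proof -
    assume *: "j < M" "0 < t" "t < d"
    then have "Suc j * d \<le> M * d" by (intro mult_le_mono1) simp
    then have "j * d + t \<le> M * d" using * by simp
    moreover have "\<not> d dvd j * d + t" using * by (simp add: dvd_add_right_iff nat_dvd_not_less)
    ultimately show ?thesis using * by (simp add: ext_word_def)
  qed
qed (auto simp: ext_word_def)

text \<open>
  The passage from the pair \<open>(d, N)\<close> to \<open>(N, 2 N + M d)\<close> at a single parameter: the image of the
  turning point under \<open>N\<close> steps lies at distance \<open>w\<close>, makes \<open>M\<close> laps near the fixed point of the
  \<open>d\<close>-th iterate, ends at distance \<open>v\<close> and then shadows the turning point for \<open>N\<close> further steps.
\<close>

lemma window_step_pointwise:
  fixes M d N :: nat and a s :: real
  defines "w \<equiv> s * crit a N" and "N' \<equiv> 2 * N + M * d"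
  defines "v \<equiv> pole a d - (a ^ d) ^ M * (pole a d - w)"
  assumes "1 < a" and d: "0 < d" "d < N" and s: "s = 1 \<or> s = -1" and "3 < a ^ N"
    and e_d: "sgn (crit a d) = - s"
    and fd: "follows a d e s" and fN: "follows a N e (- s)"
    and w: "0 < w" "w \<le> pole a d"
    and v: "w / a ^ N \<le> v" "v \<le> w / (a ^ N - 1)"
  shows "\<And>t. 0 < t \<Longrightarrow> t < N' \<Longrightarrow> sgn (crit a t) = ext_word d N M s e t"
    and "crit a N' = - s * (a ^ N * v - w)"
    and "follows a N' (ext_word d N M s e) s"
proof -
  define P where "P = pole a d"
  define b where "b = (a ^ d) ^ M"
  define \<mu> where "\<mu> = a ^ N"
  have \<mu>: "3 < \<mu>" using assms by (simp add: \<mu>_def)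
  have ad: "1 < a ^ d" using \<open>1 < a\<close> d by simp
  then have b: "1 \<le> b" by (simp add: b_def)
  have a_N': "a ^ N' = \<mu> * \<mu> * b"
    by (simp add: N'_def \<mu>_def b_def power_add mult_2 power_mult mult.commute[of M d])
  have v_pos: "0 < v" using v(1) w \<mu> by (smt (verit) \<mu>_def divide_pos_pos)
  have ss: "s * s = 1" using s by auto
  have crit_N: "crit a N = s * w" using ss by (simp add: w_def flip: mult.assoc)
  have pole_N: "pole a N = w / (\<mu> - 1)"
    using crit_N w s by (auto simp: pole_def \<mu>_def abs_mult)
  have crit_d: "crit a d = - s * \<bar>crit a d\<bar>" using e_d s by (auto simp: sgn_real_def split: if_splits)
  \<comment> \<open>The bounds on \<open>x\<close> say that it starts on the central branch of the
    \<open>N\<close>-th iterate and has not crossed \<open>0\<close> after the laps. Then three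
    known pieces compose: \<open>N\<close> steps to \<open>s * v0\<close>, the laps, and the central
    branch again.\<close>
  have claim: "(\<forall>t. 0 < t \<and> t < N' \<longrightarrow> sgn ((normal_tent a ^^ t) x) = ext_word d N M s e t) \<and>
      (normal_tent a ^^ N') x = - s * (\<mu> * v - w) + s * a ^ N' * \<bar>x\<bar>"
    if x: "\<bar>x\<bar> \<le> w / (\<mu> - 1)" "b * \<mu> * \<bar>x\<bar> < v" for x
  proof -
    define v0 where "v0 = w - \<mu> * \<bar>x\<bar>"
    have xN: "(normal_tent a ^^ N) x = s * v0"
      using fN x(1) by (simp add: follows_def pole_N crit_N v0_def \<mu>_def algebra_simps)
    have signs_N: "sgn ((normal_tent a ^^ t) x) = e t" if "0 < t" "t < N" for t
      using fN x(1) that by (simp add: follows_def pole_N)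
    have v0: "v0 \<le> P" using w \<mu> by (simp add: v0_def P_def) (smt (verit) abs_ge_zero mult_nonneg_nonneg)
    have last: "P - b * (P - v0) = v - b * \<mu> * \<bar>x\<bar>"
      by (simp add: v0_def v_def P_def b_def algebra_simps)
    note laps = follows_laps[OF fd s ad crit_d, of v0 M, folded P_def b_def, OF v0, unfolded last]
    have xM: "(normal_tent a ^^ (N + M * d)) x = s * (v - b * \<mu> * \<bar>x\<bar>)"
      using laps(1)[of M] x(2) xN last by (simp add: add.commute[of N] funpow_add b_def)
    have abs_xM: "\<bar>s * (v - b * \<mu> * \<bar>x\<bar>)\<bar> = v - b * \<mu> * \<bar>x\<bar>" using s x(2) by auto
    have "0 \<le> b * \<mu> * \<bar>x\<bar>" using b \<mu> by simp
    then have xM_le: "\<bar>s * (v - b * \<mu> * \<bar>x\<bar>)\<bar> \<le> pole a N"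
      using abs_xM v(2) by (simp add: pole_N flip: \<mu>_def)
    have split: "(normal_tent a ^^ (N + M * d + t)) x = (normal_tent a ^^ t) (s * (v - b * \<mu> * \<bar>x\<bar>))" for t
      using xM by (simp add: add.commute[of _ t] funpow_add[of t])
    have N'_eq: "N' = N + M * d + N" by (simp add: N'_def)
    have "(normal_tent a ^^ N') x = (normal_tent a ^^ N) (s * (v - b * \<mu> * \<bar>x\<bar>))"
      using split[of N] by (simp only: N'_eq)
    also have "\<dots> = crit a N - s * \<mu> * (v - b * \<mu> * \<bar>x\<bar>)"
      using fN xM_le abs_xM by (simp add: follows_def \<mu>_def)
    also have "\<dots> = - s * (\<mu> * v - w) + s * a ^ N' * \<bar>x\<bar>"
      by (simp add: crit_N a_N' algebra_simps)
    finally have val: "(normal_tent a ^^ N') x = - s * (\<mu> * v - w) + s * a ^ N' * \<bar>x\<bar>" .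
    have "sgn ((normal_tent a ^^ t) x) = ext_word d N M s e t" if t: "0 < t" "t < N'" for t
    proof -
      consider "t < N" | "N \<le> t" "t \<le> N + M * d" | "N + M * d < t" by linarith
      then show ?thesis
      proof cases
        case 1
        then show ?thesis using signs_N t by (simp add: ext_word_def)
      next
        case 2
        define j where "j = (t - N) div d"
        define t' where "t' = (t - N) mod d"
        have t_eq: "t = N + j * d + t'" using 2 by (simp add: j_def t'_def)
        have "j * d \<le> M * d" using t_eq 2 by linarith
        then have j: "j \<le> M" using d by simp
        have iter: "(normal_tent a ^^ t) x = (normal_tent a ^^ (j * d + t')) (s * v0)"
        proof -
          have "t = (j * d + t') + N" using t_eq by simp
          then show ?thesis using xN by (simp only: funpow_add o_apply)
        qed
        have dvd: "d dvd t - N \<longleftrightarrow> t' = 0" by (simp add: t'_def dvd_eq_mod_eq_0)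
        show ?thesis
        proof (cases "t' = 0")
          case True
          have "0 < P - (a ^ d) ^ j * (P - v0)" using laps(2)[of j] j x(2) by simp
          then have "sgn ((normal_tent a ^^ t) x) = s"
            using iter True laps(1)[of j] j x(2) s by (auto simp: sgn_mult)
          then show ?thesis using dvd True 2 by (simp add: ext_word_def)
        next
          case False
          moreover have "t' < d" using d by (simp add: t'_def)
          ultimately have "sgn ((normal_tent a ^^ t) x) = e t'"
            using iter laps(4)[of j t'] j x(2) by simp
          then show ?thesis using dvd False 2 by (simp add: ext_word_def t'_def)
        qed
      next
        case 3
        define t' where "t' = t - (N + M * d)"
        have t': "t = N + M * d + t'" "0 < t'" "t' < N" using 3 t by (auto simp: t'_def N'_def)
        then have "sgn ((normal_tent a ^^ t) x) = e t'"
          using split[of t'] fN xM_le by (simp add: follows_def)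
        then show ?thesis using 3 by (simp add: ext_word_def t'_def)
      qed
    qed
    with val show ?thesis by blast
  qed
  have x0: "\<bar>0::real\<bar> \<le> w / (\<mu> - 1)" "b * \<mu> * \<bar>0\<bar> < v" using w \<mu> v_pos by auto
  show "sgn (crit a t) = ext_word d N M s e t" if "0 < t" "t < N'" for t
    using claim[OF x0] that by (simp add: crit_def)
  show crit_N': "crit a N' = - s * (a ^ N * v - w)"
    using claim[OF x0] by (simp add: crit_def \<mu>_def)
  have "0 \<le> \<mu> * v - w" using v(1) \<mu> by (simp add: \<mu>_def[symmetric] divide_le_eq mult.commute)
  then have abs_N': "\<bar>crit a N'\<bar> = \<mu> * v - w" using crit_N' s by (auto simp: \<mu>_def)
  have v': "(\<mu> - 1) * v \<le> w" using v(2) \<mu> by (simp add: \<mu>_def[symmetric] le_divide_eq mult.commute)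
  have "\<mu> * (\<mu> * v - w) \<le> \<mu> * v" using v' \<mu> by (intro mult_left_mono) (auto simp: algebra_simps)
  have "\<mu> * 1 \<le> \<mu> * b" using b \<mu> by (intro mult_left_mono) auto
  then have \<mu>b: "\<mu> \<le> \<mu> * b" by simp
  have \<mu>': "9 < a ^ N'"
  proof -
    have "9 < 3 * \<mu>" using \<mu> by simp
    also have "3 \<le> \<mu> * b" using \<mu>b \<mu> by linarith
    then have "3 * \<mu> \<le> (\<mu> * b) * \<mu>" using \<mu> by (intro mult_right_mono) auto
    also have "\<dots> = a ^ N'" by (simp add: a_N')
    finally show ?thesis .
  qed
  have 1: "\<mu> * v - w \<le> w / (\<mu> - 1)"
  proof -
    have "(\<mu> - 1) * (\<mu> * v - w) \<le> (\<mu> - 1) * v" using v' \<mu> by (intro mult_left_mono) (auto simp: algebra_simps)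
    also have "\<dots> \<le> w" by (rule v')
    finally show ?thesis using \<mu> by (simp add: le_divide_eq mult.commute)
  qed
  show "follows a N' (ext_word d N M s e) s"
    unfolding follows_def
  proof (intro allI impI)
    fix x assume "\<bar>x\<bar> \<le> pole a N'"
    then have x: "\<bar>x\<bar> * (a ^ N' - 1) \<le> \<mu> * v - w"
      using \<mu>' by (simp add: pole_def abs_N' le_divide_eq)
    have "\<bar>x\<bar> * 1 \<le> \<bar>x\<bar> * (a ^ N' - 1)" using \<mu>' by (intro mult_left_mono) auto
    then have x1: "\<bar>x\<bar> \<le> w / (\<mu> - 1)" using x 1 by linarith
    \<comment> \<open>Passing from \<open>a ^ N' - 1\<close> to half of \<open>a ^ N'\<close> costs
      a factor \<open>2\<close>, which \<open>3 < \<mu>\<close> absorbs.\<close>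
    have "\<bar>x\<bar> * (a ^ N' / 2) \<le> \<bar>x\<bar> * (a ^ N' - 1)" using \<mu>' by (intro mult_left_mono) auto
    with x have "\<bar>x\<bar> * (\<mu> * \<mu> * b) \<le> 2 * (\<mu> * v - w)" by (simp add: a_N')
    also have "\<mu> * v - w \<le> v" using v' by (simp add: algebra_simps)
    finally have "\<mu> * (b * \<mu> * \<bar>x\<bar>) \<le> 2 * v" by (simp add: ac_simps)
    also have "\<dots> < \<mu> * v" using \<mu> v_pos by simp
    finally have x2: "b * \<mu> * \<bar>x\<bar> < v" using \<mu> by simp
    show "(\<forall>t. 0 < t \<and> t < N' \<longrightarrow> sgn ((normal_tent a ^^ t) x) = ext_word d N M s e t) \<and>
        (normal_tent a ^^ N') x = crit a N' + s * a ^ N' * \<bar>x\<bar>"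
      using claim[OF x1 x2] crit_N' by (simp add: \<mu>_def)
  qed
qed

text \<open>
  The \<open>N\<close>-th iterate sweeps from the turning point to the periodic point belonging to \<open>d\<close>. The sign \<open>s\<close> is
  the side of that point; it makes the \<open>d\<close>-th iterate turn at a minimum and the \<open>N\<close>-th at a maximum if
  \<open>s = 1\<close>, and conversely if \<open>s = - 1\<close>.
\<close>

definition window :: "real \<Rightarrow> real \<Rightarrow> (nat \<Rightarrow> real) \<Rightarrow> nat \<Rightarrow> nat \<Rightarrow> real \<Rightarrow> bool" where
  "window l u e d N s \<longleftrightarrow> sqrt 2 \<le> l \<and> l < u \<and> u \<le> 2 \<and> 0 < d \<and> d < N \<and> 4 \<le> N \<and> (s = 1 \<or> s = -1) \<and>
    e d = - s \<and> (\<forall>t. 0 < t \<and> t < N \<longrightarrow> e t \<noteq> 0) \<and>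
    (\<forall>a\<in>{l..u}. (\<forall>t. 0 < t \<and> t < N \<longrightarrow> sgn (crit a t) = e t) \<and>
      follows a d e s \<and> follows a N e (- s) \<and> 0 \<le> s * crit a N \<and> s * crit a N \<le> pole a d) \<and>
    (crit l N = 0 \<and> s * crit u N = pole u d \<or> crit u N = 0 \<and> s * crit l N = pole l d)"

text \<open>Two successive cuts: on the first subinterval the position \<open>v\<close> after the
  laps sweeps from \<open>0\<close> to the pole of \<open>d\<close>, and inside it the value after
  \<open>N\<close> further steps sweeps from \<open>0\<close> to the pole of
  \<open>N\<close>.\<close>

lemma window_step:
  fixes M d N :: nat
  assumes win: "window l u e d N s" and M: "0 < M"
  obtains l' u' where "l \<le> l'" "u' \<le> u" "window l' u' (ext_word d N M s e) N (2 * N + M * d) (- s)"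
proof -
  define P w v where "P a = pole a d" and "w a = s * crit a N"
    and "v a = P a - (a ^ d) ^ M * (P a - w a)" for a
  \<comment> \<open>\<open>h\<close> is the size of the new critical value in units of
    \<open>pole a N\<close>.\<close>
  define h where "h a = (a ^ N * v a - w a) * (a ^ N - 1) / w a" for a
  have lu: "sqrt 2 \<le> l" "l < u" "u \<le> 2" and d: "0 < d" "d < N" "4 \<le> N" and s: "s = 1 \<or> s = -1"
    and e: "e d = - s" "\<And>t. 0 < t \<Longrightarrow> t < N \<Longrightarrow> e t \<noteq> 0"
    and ends: "crit l N = 0 \<and> s * crit u N = pole u d \<or> crit u N = 0 \<and> s * crit l N = pole l d"
    using win by (auto simp: window_def)
  have pt: "\<And>t. 0 < t \<Longrightarrow> t < N \<Longrightarrow> sgn (crit a t) = e t" "follows a d e s" "follows a N e (- s)"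
      "0 \<le> w a" "w a \<le> P a" if "a \<in> {l..u}" for a
    using win that by (auto simp: window_def P_def w_def)
  have s2: "1 < sqrt 2" by simp
  have a_ge: "sqrt 2 \<le> a" "1 < a" if "a \<in> {l..u}" for a
  proof -
    show "sqrt 2 \<le> a" using that lu by simp
    then show "1 < a" using s2 by linarith
  qed
  have a_N: "3 < a ^ N" if "a \<in> {l..u}" for a
  proof -
    have "4 = sqrt 2 ^ 4" by (simp add: power4_eq_xxxx)
    also have "\<dots> \<le> a ^ 4" using a_ge[OF that] by (intro power_mono) auto
    also have "\<dots> \<le> a ^ N" using a_ge[OF that] d by (intro power_increasing) auto
    finally show ?thesis by simp
  qed
  have a_d: "1 < a ^ d" if "a \<in> {l..u}" for a
    using a_ge[OF that] d by simp
  have P_pos: "0 < P a" if "a \<in> {l..u}" for a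
  proof -
    have "crit a d \<noteq> 0" using pt(1)[OF that, of d] d e(1) s by auto
    then show ?thesis using a_d[OF that] by (simp add: P_def pole_def)
  qed
  have cont_P: "continuous_on {l..u} P"
    unfolding P_def pole_def using a_d by (force intro!: continuous_intros continuous_on_crit)
  have cont_w: "continuous_on A w" for A
    unfolding w_def by (intro continuous_intros continuous_on_crit)
  have cont_v: "continuous_on {l..u} v"
    unfolding v_def by (intro continuous_intros cont_P cont_w)
  have v_low: "v a \<le> 0" if "a \<in> {l..u}" "w a = 0" for a
    using one_le_power[of "a ^ d" M] a_d[OF that(1)] P_pos[OF that(1)] that(2)
    by (simp add: v_def mult_le_cancel_right1)
  have v_high: "v a = P a" if "w a = P a" for a using that by (simp add: v_def)
  obtain l1 u1 where 1: "l \<le> l1" "l1 < u1" "u1 \<le> u" "\<And>a. a \<in> {l1..u1} \<Longrightarrow> 0 \<le> v a / P a \<and> v a / P a \<le> 1"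
    "v l1 / P l1 = 0 \<and> v u1 / P u1 = 1 \<or> v l1 / P l1 = 1 \<and> v u1 / P u1 = 0"
  proof (rule crossing_subinterval)
    show "continuous_on {l..u} (\<lambda>a. v a / P a)"
      using P_pos by (force intro!: continuous_intros cont_v cont_P)
    show "v l / P l \<le> 0 \<and> 1 \<le> v u / P u \<or> 1 \<le> v l / P l \<and> v u / P u \<le> 0"
      using ends lu P_pos[of l] P_pos[of u] v_low[of l] v_low[of u] v_high[of l] v_high[of u]
      by (auto simp: w_def divide_le_0_iff simp flip: P_def)
  qed (use lu in auto)
  have sub: "a \<in> {l..u}" if "a \<in> {l1..u1}" for a using that 1 by auto
  have v_range: "0 \<le> v a" "v a \<le> P a" if "a \<in> {l1..u1}" for a
    using 1(4)[OF that] P_pos[OF sub[OF that]] by (auto simp: zero_le_divide_iff)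
  \<comment> \<open>The first cut removes the zeros of \<open>w\<close>, since \<open>v\<close> is
    negative there; this makes the division in \<open>h\<close> legitimate.\<close>
  have w_pos: "0 < w a" if "a \<in> {l1..u1}" for a
  proof (rule ccontr)
    assume "\<not> 0 < w a"
    then have "w a = 0" using pt(4)[OF sub[OF that]] by simp
    then have "v a = P a * (1 - (a ^ d) ^ M)" by (simp add: v_def algebra_simps)
    moreover have "1 < (a ^ d) ^ M" using a_d[OF sub[OF that]] M by simp
    ultimately have "v a < 0" using P_pos[OF sub[OF that]] by (simp add: mult_less_0_iff)
    then show False using v_range[OF that] by simp
  qed
  have h_low: "h a \<le> 0" if "a \<in> {l1..u1}" "v a = 0" for a
    using that w_pos[OF that(1)] a_N[OF sub[OF that(1)]] by (simp add: h_def)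
  \<comment> \<open>A point that is at the pole after the laps was there before them, so
    \<open>w a = P a\<close>.\<close>
  have h_high: "1 \<le> h a" if a: "a \<in> {l1..u1}" "v a = P a" for a
  proof -
    have "(a ^ d) ^ M * (P a - w a) = 0" using a by (simp add: v_def)
    then have "w a = P a" using a_d[OF sub[OF a(1)]] a_ge[OF sub[OF a(1)]] by auto
    then have "h a = (a ^ N - 1) * (a ^ N - 1)"
      using w_pos[OF a(1)] a(2) by (simp add: h_def field_simps)
    moreover have "1 * 1 \<le> (a ^ N - 1) * (a ^ N - 1)"
      using a_N[OF sub[OF a(1)]] by (intro mult_mono) auto
    ultimately show ?thesis by simp
  qed
  obtain l' u' where 2: "l1 \<le> l'" "l' < u'" "u' \<le> u1" "\<And>a. a \<in> {l'..u'} \<Longrightarrow> 0 \<le> h a \<and> h a \<le> 1"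
    "h l' = 0 \<and> h u' = 1 \<or> h l' = 1 \<and> h u' = 0"
  proof (rule crossing_subinterval)
    have "continuous_on {l1..u1} v" using cont_v by (rule continuous_on_subset) (use sub in auto)
    then show "continuous_on {l1..u1} h"
      unfolding h_def using w_pos by (force intro!: continuous_intros cont_w)
    show "h l1 \<le> 0 \<and> 1 \<le> h u1 \<or> 1 \<le> h l1 \<and> h u1 \<le> 0"
      using 1 h_low[of l1] h_low[of u1] h_high[of l1] h_high[of u1] P_pos[of l1] P_pos[of u1]
      by auto
  qed (use 1 in auto)
  have step: "(\<forall>t. 0 < t \<and> t < 2 * N + M * d \<longrightarrow> sgn (crit a t) = ext_word d N M s e t)"
    "follows a (2 * N + M * d) (ext_word d N M s e) s"
    "follows a N (ext_word d N M s e) (- s)"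
    "- s * crit a (2 * N + M * d) = h a * pole a N" "0 < pole a N"
    if a: "a \<in> {l'..u'}" for a
  proof -
    have a1: "a \<in> {l1..u1}" using a 2 by auto
    note a0 = sub[OF a1]
    note N3 = a_N[OF a0]
    have ha: "h a * w a = (a ^ N * v a - w a) * (a ^ N - 1)"
      using w_pos[OF a1] by (simp add: h_def)
    have pole_N: "pole a N = w a / (a ^ N - 1)"
      using w_pos[OF a1] s by (auto simp: pole_def w_def abs_if)
    have "0 \<le> a ^ N * v a - w a"
      using 2(4)[OF a] w_pos[OF a1] N3 ha
      by (smt (verit) mult_nonneg_nonneg mult_neg_pos)
    then have v1: "w a / a ^ N \<le> v a" using N3 by (simp add: divide_le_eq mult.commute)
    have "h a * w a \<le> 1 * w a" using 2(4)[OF a] w_pos[OF a1] by (intro mult_right_mono) auto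
    then have "a ^ N * ((a ^ N - 1) * v a) \<le> a ^ N * w a" using ha by (simp add: algebra_simps)
    then have v2: "v a \<le> w a / (a ^ N - 1)" using N3 by (simp add: le_divide_eq mult.commute)
    have "sgn (crit a d) = - s" using pt(1)[OF a0, of d] d e by simp
    note thms = window_step_pointwise[OF a_ge(2)[OF a0] d(1,2) s N3 this pt(2,3)[OF a0],
        of M, folded w_def P_def, folded v_def, OF w_pos[OF a1] pt(5)[OF a0] v1 v2]
    show "\<forall>t. 0 < t \<and> t < 2 * N + M * d \<longrightarrow> sgn (crit a t) = ext_word d N M s e t"
      using thms(1) by blast
    show "follows a (2 * N + M * d) (ext_word d N M s e) s" by (rule thms(3))
    show "follows a N (ext_word d N M s e) (- s)"
      using pt(3)[OF a0] by (auto simp: follows_def ext_word_def)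
    show "- s * crit a (2 * N + M * d) = h a * pole a N"
      using thms(2) s N3 ha by (auto simp: pole_N)
    show "0 < pole a N" using w_pos[OF a1] N3 by (simp add: pole_N)
  qed
  have e_N: "ext_word d N M s e N = s" using ext_word_simps(2)[of d N 0 M s e] d by simp
  have e_nz: "ext_word d N M s e t \<noteq> 0" if "0 < t" "t < 2 * N + M * d" for t
  proof -
    show ?thesis
    proof (cases "t < N \<or> N + M * d < t")
      case True
      then show ?thesis using e(2) that by (auto simp: ext_word_def)
    next
      case False
      then show ?thesis
        using e(2)[of "(t - N) mod d"] s less_trans[OF mod_less_divisor[OF d(1)] d(2)]
        by (auto simp: ext_word_def mod_greater_zero_iff_not_dvd)
    qed
  qed
  have bounds: "- s * crit a (2 * N + M * d) \<le> pole a N" "0 \<le> - s * crit a (2 * N + M * d)"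
    if "a \<in> {l'..u'}" for a
    using step(4,5)[OF that] 2(4)[OF that] by (simp_all add: mult_left_le_one_le)
  have ends': "crit l' (2 * N + M * d) = 0 \<and> - s * crit u' (2 * N + M * d) = pole u' N \<or>
      crit u' (2 * N + M * d) = 0 \<and> - s * crit l' (2 * N + M * d) = pole l' N"
    using 2(5) step(4)[of l'] step(4)[of u'] 2(2) s by auto
  have "sqrt 2 \<le> l'" "u' \<le> 2" using lu 1 2 by auto
  moreover have "N < 2 * N + M * d" "4 \<le> 2 * N + M * d" "0 < N" "- s = 1 \<or> - s = -1" using d s by auto
  ultimately have "window l' u' (ext_word d N M s e) N (2 * N + M * d) (- s)"
    unfolding window_def minus_minus using step(1-3) 2(2) e_N e_nz bounds ends' by blast
  then show thesis using that[of l' u'] 1 2 by simp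
qed

section \<open>Initial windows\<close>

lemma nonzero_same_sign:
  fixes h :: "real \<Rightarrow> real"
  assumes "continuous_on {l..u} h" "\<And>x. l < x \<Longrightarrow> x < u \<Longrightarrow> h x \<noteq> 0" "a \<in> {l..u}" "b \<in> {l..u}"
  shows "0 \<le> h a * h b"
proof -
  have main: "0 \<le> h a * h b" if "a < b" "a \<in> {l..u}" "b \<in> {l..u}" for a b
  proof (rule ccontr)
    assume neg: "\<not> 0 \<le> h a * h b"
    have cont: "continuous_on {a..b} h" using assms(1) that by (auto intro: continuous_on_subset)
    have "h a \<le> 0 \<and> 0 \<le> h b \<or> h b \<le> 0 \<and> 0 \<le> h a"
      using neg by (auto simp: not_le mult_less_0_iff)
    then obtain x where x: "a \<le> x" "x \<le> b" "h x = 0"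
      using IVT'[of h a 0 b, OF _ _ less_imp_le[OF \<open>a < b\<close>] cont]
        IVT2'[of h b 0 a, OF _ _ less_imp_le[OF \<open>a < b\<close>] cont] by blast
    moreover have "x \<noteq> a" "x \<noteq> b" using neg x by auto
    ultimately show False using assms(2)[of x] that by auto
  qed
  show ?thesis using main[of a b] main[of b a] assms(3,4)
    by (cases a b rule: linorder_cases) (auto simp: mult.commute)
qed

text \<open>The parameter acts through the previous value, magnified by \<open>a\<close>, and
  explicitly, by at most \<open>a' - a\<close>. Values on one side of \<open>0\<close> are not
  folded together.\<close>

lemma crit_difference_Suc:
  assumes "0 \<le> a" "a < a'" "a' \<le> 2" "0 \<le> crit a n * crit a' n"
  shows "a * \<bar>crit a' n - crit a n\<bar> - (a' - a) \<le> \<bar>crit a' (Suc n) - crit a (Suc n)\<bar>"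
proof -
  let ?y = "crit a n" and ?y' = "crit a' n"
  have eq: "\<bar>\<bar>?y'\<bar> - \<bar>?y\<bar>\<bar> = \<bar>?y' - ?y\<bar>"
    using assms(4) by (auto simp: zero_le_mult_iff abs_if)
  have "crit a (Suc n) - crit a' (Suc n) = a * (\<bar>?y'\<bar> - \<bar>?y\<bar>) + (a' - a) * \<bar>?y'\<bar>"
    by (simp add: crit_Suc algebra_simps)
  then have "\<bar>a * (\<bar>?y'\<bar> - \<bar>?y\<bar>)\<bar> - \<bar>(a' - a) * \<bar>?y'\<bar>\<bar> \<le> \<bar>crit a' (Suc n) - crit a (Suc n)\<bar>"
    by linarith
  moreover have "\<bar>(a' - a) * \<bar>?y'\<bar>\<bar> \<le> a' - a"
    using abs_crit_le_1[of a' n] assms by (simp add: abs_mult mult_left_le)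
  moreover have "\<bar>a * (\<bar>?y'\<bar> - \<bar>?y\<bar>)\<bar> = a * \<bar>?y' - ?y\<bar>"
    using assms(1) by (simp add: abs_mult eq)
  ultimately show ?thesis by linarith
qed

text \<open>A finite-difference form of the bound \<open>\<rho>\<close> from below on the slope of
  \<open>crit a n\<close> in the parameter, on an interval of constant earlier itinerary.\<close>

definition expanding :: "real \<Rightarrow> real \<Rightarrow> nat \<Rightarrow> real \<Rightarrow> bool" where
  "expanding l u n \<rho> \<longleftrightarrow> l < u \<and> (\<forall>t a. 0 < t \<and> t < n \<and> l < a \<and> a < u \<longrightarrow> crit a t \<noteq> 0) \<and>
    (\<forall>a a'. l \<le> a \<and> a < a' \<and> a' \<le> u \<longrightarrow> \<rho> * (a' - a) \<le> \<bar>crit a' n - crit a n\<bar>)"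

lemma expanding_subinterval:
  assumes "expanding l u n \<rho>" "l \<le> l'" "l' < u'" "u' \<le> u" "\<rho>' \<le> \<rho>"
  shows "expanding l' u' n \<rho>'"
proof -
  have "\<rho>' * (a' - a) \<le> \<bar>crit a' n - crit a n\<bar>" if "l' \<le> a" "a < a'" "a' \<le> u'" for a a'
  proof -
    have "\<rho>' * (a' - a) \<le> \<rho> * (a' - a)" using assms(5) that by (intro mult_right_mono) auto
    also have "\<dots> \<le> \<bar>crit a' n - crit a n\<bar>" using assms(1,2,4) that by (simp add: expanding_def)
    finally show ?thesis .
  qed
  moreover have "crit a t \<noteq> 0" if "0 < t" "t < n" "l' < a" "a < u'" for t a
    using assms(1,2,4) that by (simp add: expanding_def)
  ultimately show ?thesis using assms(3) by (simp add: expanding_def)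
qed

lemma expanding_Suc:
  assumes ex: "expanding l u n \<rho>" and "0 \<le> p" "p \<le> l" "u \<le> 2" "0 \<le> \<rho>"
    and nz: "\<And>a. l < a \<Longrightarrow> a < u \<Longrightarrow> crit a n \<noteq> 0"
  shows "expanding l u (Suc n) (p * \<rho> - 1)"
    and "p * \<bar>crit u n - crit l n\<bar> - (u - l) \<le> \<bar>crit u (Suc n) - crit l (Suc n)\<bar>"
proof -
  have *: "p * \<bar>crit a' n - crit a n\<bar> - (a' - a) \<le> \<bar>crit a' (Suc n) - crit a (Suc n)\<bar>"
    if "l \<le> a" "a < a'" "a' \<le> u" for a a'
  proof -
    have "0 \<le> crit a n * crit a' n"
      using that by (intro nonzero_same_sign[OF continuous_on_crit nz]) auto
    then have "a * \<bar>crit a' n - crit a n\<bar> - (a' - a) \<le> \<bar>crit a' (Suc n) - crit a (Suc n)\<bar>"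
      using assms that by (intro crit_difference_Suc) auto
    moreover have "p * \<bar>crit a' n - crit a n\<bar> \<le> a * \<bar>crit a' n - crit a n\<bar>"
      using assms that by (intro mult_right_mono) auto
    ultimately show ?thesis by linarith
  qed
  show "p * \<bar>crit u n - crit l n\<bar> - (u - l) \<le> \<bar>crit u (Suc n) - crit l (Suc n)\<bar>"
    using *[of l u] ex by (simp add: expanding_def)
  have "(p * \<rho> - 1) * (a' - a) \<le> \<bar>crit a' (Suc n) - crit a (Suc n)\<bar>"
    if "l \<le> a" "a < a'" "a' \<le> u" for a a'
  proof -
    have "\<rho> * (a' - a) \<le> \<bar>crit a' n - crit a n\<bar>" using ex that by (simp add: expanding_def)
    then have "p * (\<rho> * (a' - a)) \<le> p * \<bar>crit a' n - crit a n\<bar>"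
      using assms by (intro mult_left_mono) auto
    then show ?thesis using *[OF that] by (simp add: algebra_simps)
  qed
  moreover have "crit a t \<noteq> 0" if "0 < t" "t < Suc n" "l < a" "a < u" for t a
    using ex nz[of a] that by (cases "t = n") (auto simp: expanding_def)
  moreover have "l < u" using ex by (simp add: expanding_def)
  ultimately show "expanding l u (Suc n) (p * \<rho> - 1)" by (simp add: expanding_def)
qed

lemma expanding_nonzero:
  assumes "expanding l u n \<rho>" "0 < \<rho>" "z \<in> {l..u}" "crit z n = 0" "a \<in> {l..u}" "a \<noteq> z"
  shows "crit a n \<noteq> 0"
proof
  assume "crit a n = 0"
  moreover have "0 < \<rho> * \<bar>a - z\<bar>" using assms by simp
  moreover have "\<rho> * \<bar>a - z\<bar> \<le> \<bar>crit a n - crit z n\<bar>"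
  proof (cases "a < z")
    case True
    then have "\<rho> * (z - a) \<le> \<bar>crit z n - crit a n\<bar>" using assms(1,3,5) by (simp add: expanding_def)
    then show ?thesis using True by (simp add: abs_minus_commute)
  next
    case False
    then show ?thesis using assms(1,3,5,6) by (simp add: expanding_def)
  qed
  ultimately show False using assms(4) by linarith
qed

text \<open>One step turns the slope \<open>\<rho>\<close> into \<open>p * \<rho> - 1\<close>, so it
  grows only from above the fixed point \<open>1 / (p - 1)\<close>. The third iterate starts above
  it for \<open>p \<ge> 3 / 2\<close>, the fifth for smaller \<open>p\<close>.\<close>

lemma expanding_initial:
  assumes "sqrt 2 \<le> p" "p < q" "q \<le> 2"
  obtains l u n \<rho> where "p \<le> l" "u \<le> q" "0 < n" "expanding l u n \<rho>" "1 < (p - 1) * \<rho>"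
proof (cases "3 / 2 \<le> p")
  case True
  \<comment> \<open>At \<open>p = 3 / 2\<close> the left end would give equality only; the midpoint
    makes the inequality strict.\<close>
  define l where "l = (p + q) / 2"
  have l: "p < l" "l < q" using assms by (auto simp: l_def)
  have crit3: "crit a 3 = 1 + a - a * a" if "3 / 2 \<le> a" for a
    using that by (simp add: crit_Suc numeral_3_eq_3 algebra_simps)
  have "expanding l q 3 (2 * l - 1)"
    unfolding expanding_def
  proof (intro conjI allI impI)
    fix t :: nat and a assume "0 < t \<and> t < 3 \<and> l < a \<and> a < q"
    then show "crit a t \<noteq> 0" using l True by (auto simp: less_Suc_eq numeral_3_eq_3 crit_Suc)
  next
    fix a a' assume a: "l \<le> a \<and> a < a' \<and> a' \<le> q"
    have "(2 * l - 1) * (a' - a) \<le> (a + a' - 1) * (a' - a)"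
      using a by (intro mult_right_mono) auto
    also have "\<dots> = crit a 3 - crit a' 3"
      using a l True by (simp add: crit3 algebra_simps)
    finally show "(2 * l - 1) * (a' - a) \<le> \<bar>crit a' 3 - crit a 3\<bar>" by linarith
  qed (use l in auto)
  moreover have "1 < (p - 1) * (2 * l - 1)"
  proof -
    have "1 / 2 * 2 \<le> (p - 1) * (2 * p - 1)" using True by (intro mult_mono) auto
    also have "\<dots> < (p - 1) * (2 * l - 1)" using l True by (intro mult_strict_left_mono) auto
    finally show ?thesis by simp
  qed
  ultimately show thesis using that[of l q 3] l by simp
next
  case False
  define u where "u = min q (3 / 2)"
  have u: "p < u" "u \<le> q" "u \<le> 3 / 2" using False assms by (auto simp: u_def)
  have s2: "7 / 5 \<le> sqrt 2" by (rule real_le_rsqrt) (simp add: power2_eq_square)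
  have range: "7 / 5 \<le> a" "a \<le> 3 / 2" "2 \<le> a * a" if "p \<le> a" "a \<le> u" for a
  proof -
    show "7 / 5 \<le> a" "a \<le> 3 / 2" using that s2 assms u by auto
    have "sqrt 2 \<le> a" using that assms by linarith
    then have "sqrt 2 * sqrt 2 \<le> a * a" using \<open>7 / 5 \<le> a\<close> by (intro mult_mono) auto
    then show "2 \<le> a * a" by simp
  qed
  have crit2: "crit a 2 = 1 - a" for a by (simp add: crit_Suc numeral_2_eq_2)
  have crit3: "crit a 3 = 1 + a - a * a" if "p \<le> a" "a \<le> u" for a
    using range[OF that] by (simp add: crit_Suc numeral_3_eq_3 algebra_simps)
  have crit3_pos: "0 < crit a 3" if "p \<le> a" "a \<le> u" for a
  proof -
    have "a * (a - 1) \<le> 3 / 2 * (1 / 2)" using range[OF that] by (intro mult_mono) auto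
    then show ?thesis using crit3[OF that] by (simp add: algebra_simps)
  qed
  have crit4: "crit a 4 = (a - 1) * (a - 1) * (a + 1)" if "p \<le> a" "a \<le> u" for a
  proof -
    have "crit a 4 = 1 - a * \<bar>crit a 3\<bar>" by (simp add: crit_Suc eval_nat_numeral)
    then show ?thesis using crit3_pos[OF that] crit3[OF that] by (simp add: algebra_simps)
  qed
  have crit4_pos: "0 < crit a 4" if "p \<le> a" "a \<le> u" for a
    using range[OF that] crit4[OF that] by simp
  have crit5: "crit a 5 = 1 - a * crit a 4" if "p \<le> a" "a \<le> u" for a
  proof -
    have "crit a 5 = 1 - a * \<bar>crit a 4\<bar>" by (simp add: crit_Suc eval_nat_numeral)
    then show ?thesis using crit4_pos[OF that] by simp
  qed
  \<comment> \<open>\<open>14 / 5\<close> is \<open>7 / 5\<close> times the slope bound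
    \<open>2\<close> of the fourth iterate, and \<open>2 / 5 * (14 / 5) > 1\<close>.\<close>
  have "expanding p u 5 (14 / 5)"
    unfolding expanding_def
  proof (intro conjI allI impI)
    fix t :: nat and a assume *: "0 < t \<and> t < 5 \<and> p < a \<and> a < u"
    then consider "t = 1" | "t = 2" | "t = 3" | "t = 4" by linarith
    then show "crit a t \<noteq> 0"
      using * range[of a] crit3_pos[of a] crit4_pos[of a] crit2 by cases auto
  next
    fix a a' assume a: "p \<le> a \<and> a < a' \<and> a' \<le> u"
    then have ra: "7 / 5 \<le> a" "2 \<le> a * a" "7 / 5 \<le> a'" "2 \<le> a' * a'" "a \<le> 3 / 2" "a' \<le> 3 / 2"
      using range[of a] range[of a'] by auto
    define g where "g = a * a + a * a' + a' * a' - (a + a') - 1"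
    have g: "2 \<le> g"
    proof -
      \<comment> \<open>Expanding \<open>25 * (g - 2)\<close> around \<open>7 / 5\<close> leaves
        nonnegative coefficients only.\<close>
      have "0 \<le> (5 * a - 7) * (5 * a - 7) + (5 * a - 7) * (5 * a' - 7) + (5 * a' - 7) * (5 * a' - 7) +
          16 * (5 * a - 7 + (5 * a' - 7)) + 2"
        using ra by (intro add_nonneg_nonneg mult_nonneg_nonneg) auto
      also have "\<dots> = 25 * (g - 2)" by (simp add: g_def algebra_simps)
      finally show ?thesis by simp
    qed
    have "crit a' 4 - crit a 4 = g * (a' - a)"
      using a by (simp add: crit4 g_def algebra_simps)
    moreover have "crit a 5 - crit a' 5 = a' * (crit a' 4 - crit a 4) + (a' - a) * crit a 4"
      using a by (simp add: crit5 algebra_simps)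
    ultimately have "crit a 5 - crit a' 5 = a' * g * (a' - a) + (a' - a) * crit a 4" by simp
    moreover have "0 \<le> (a' - a) * crit a 4" using crit4_pos[of a] a by simp
    moreover have "7 / 5 * 2 \<le> a' * g" using ra g by (intro mult_mono) auto
    then have "14 / 5 * (a' - a) \<le> a' * g * (a' - a)" using a by (intro mult_right_mono) auto
    ultimately show "14 / 5 * (a' - a) \<le> \<bar>crit a' 5 - crit a 5\<bar>" by linarith
  qed (use u in auto)
  then show thesis using that[of p u 5 "14 / 5"] u s2 assms by simp
qed

text \<open>Every step gains at least the initial surplus \<open>\<delta>\<close> of slope. An
  interval with a zero inside is cut there, which preserves the slope bound.\<close>

lemma expanding_large:
  assumes "sqrt 2 \<le> p" "p < q" "q \<le> 2"
  obtains l u n where "p \<le> l" "u \<le> q" "0 < n" "expanding l u n R"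
proof -
  have "1 < sqrt 2" by simp
  then have p: "1 < p" using assms by linarith
  obtain l0 u0 n0 \<rho> where init: "p \<le> l0" "u0 \<le> q" "0 < n0" "expanding l0 u0 n0 \<rho>" "1 < (p - 1) * \<rho>"
    using expanding_initial[OF assms] by blast
  define \<delta> where "\<delta> = (p - 1) * \<rho> - 1"
  have "0 < \<delta>" using init by (simp add: \<delta>_def)
  have "0 < \<rho>" using init(5) p by (smt (verit) mult_nonneg_nonpos)
  have "\<exists>l u n. p \<le> l \<and> u \<le> q \<and> 0 < n \<and> expanding l u n (\<rho> + real k * \<delta>)" for k
  proof (induction k)
    case 0
    show ?case using init by auto
  next
    case (Suc k)
    then obtain l u n where ih: "p \<le> l" "u \<le> q" "0 < n" "expanding l u n (\<rho> + real k * \<delta>)" by blast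
    let ?\<rho> = "\<rho> + real k * \<delta>"
    have pos: "0 < ?\<rho>" using \<open>0 < \<rho>\<close> \<open>0 < \<delta>\<close> by (simp add: add_pos_nonneg)
    have "0 \<le> (p - 1) * (real k * \<delta>)" using p \<open>0 < \<delta>\<close> by simp
    then have grow: "\<rho> + real (Suc k) * \<delta> \<le> p * ?\<rho> - 1"
      by (simp add: \<delta>_def algebra_simps)
    have lu: "l < u" using ih by (simp add: expanding_def)
    have "\<exists>l' u'. l \<le> l' \<and> l' < u' \<and> u' \<le> u \<and> (\<forall>a. l' < a \<and> a < u' \<longrightarrow> crit a n \<noteq> 0)"
    proof (cases "\<exists>z. l < z \<and> z < u \<and> crit z n = 0")
      case True
      then obtain z where z: "l < z" "z < u" "crit z n = 0" by blast
      then have "crit a n \<noteq> 0" if "l < a" "a < z" for a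
        using expanding_nonzero[OF ih(4) pos, of z a] that by auto
      then show ?thesis using z by (intro exI[of _ l] exI[of _ z]) auto
    next
      case False
      then show ?thesis using lu by blast
    qed
    then obtain l' u' where sub: "l \<le> l'" "l' < u'" "u' \<le> u" "\<And>a. l' < a \<Longrightarrow> a < u' \<Longrightarrow> crit a n \<noteq> 0"
      by blast
    have "expanding l' u' (Suc n) (p * ?\<rho> - 1)"
    proof (rule expanding_Suc(1))
      show "expanding l' u' n ?\<rho>" using expanding_subinterval[OF ih(4) sub(1-3)] by simp
    qed (use p ih sub assms pos in auto)
    then have "expanding l' u' (Suc n) (\<rho> + real (Suc k) * \<delta>)"
      using expanding_subinterval grow sub(2) by blast
    then show ?case using ih sub by (intro exI[of _ l'] exI[of _ u'] exI[of _ "Suc n"]) auto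
  qed
  moreover obtain k where "(R - \<rho>) / \<delta> \<le> real k" using real_arch_simple by blast
  then have "R \<le> \<rho> + real k * \<delta>" using \<open>0 < \<delta>\<close> by (simp add: divide_le_eq)
  ultimately obtain l u n where lun: "p \<le> l" "u \<le> q" "0 < n" "expanding l u n (\<rho> + real k * \<delta>)"
    by blast
  then have "l < u" by (simp add: expanding_def)
  then have "expanding l u n R"
    using expanding_subinterval[OF lun(4) order_refl _ order_refl \<open>R \<le> _\<close>] by blast
  then show thesis using that lun by blast
qed

text \<open>At \<open>z\<close> the iterate number \<open>Suc n\<close> is \<open>1\<close>, at
  \<open>z'\<close> it is \<open>0\<close>; in between it sweeps across the fixed point.\<close>

definition double_cut :: "real \<Rightarrow> real \<Rightarrow> bool" where
  "double_cut p q \<longleftrightarrow> (\<exists>n z z'. 0 < n \<and> z \<in> {p..q} \<and> z' \<in> {p..q} \<and> z \<noteq> z' \<and> crit z n = 0 \<and>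
    crit z' (Suc n) = 0 \<and>
    (\<forall>a t. 0 < t \<and> t \<le> n \<and> a \<in> {min z z'..max z z'} \<and> a \<noteq> z \<longrightarrow> crit a t \<noteq> 0))"

text \<open>An uncut interval grows by \<open>\<kappa>\<close>. Otherwise the half with the longer
  image is kept; without a double cut its next two steps are uncut, so the net factor is
  \<open>\<kappa> * \<kappa> / 2\<close>.\<close>

lemma growth_step:
  assumes pq: "1 < p" "q \<le> 2" and R: "0 < R" "R \<le> p * R - 1"
    and ex: "p \<le> l" "u \<le> q" "0 < n" "expanding l u n R" and "\<not> double_cut p q"
    and \<kappa>: "\<kappa> = p - 1 / R" "1 \<le> \<kappa>"
  shows "\<exists>l' u' n'. p \<le> l' \<and> u' \<le> q \<and> 0 < n' \<and> expanding l' u' n' R \<and>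
    min \<kappa> (\<kappa> * \<kappa> / 2) * \<bar>crit u n - crit l n\<bar> \<le> \<bar>crit u' n' - crit l' n'\<bar>"
proof -
  have step: "expanding l u (Suc n) R \<and> \<kappa> * \<bar>crit u n - crit l n\<bar> \<le> \<bar>crit u (Suc n) - crit l (Suc n)\<bar>"
    if "p \<le> l" "u \<le> q" "expanding l u n R" "\<And>a. l < a \<Longrightarrow> a < u \<Longrightarrow> crit a n \<noteq> 0" for l u n
  proof
    have lu: "l < u" using that by (simp add: expanding_def)
    have "expanding l u (Suc n) (p * R - 1)"
      using that pq R by (intro expanding_Suc(1)) auto
    then show "expanding l u (Suc n) R" using expanding_subinterval R lu by blast
    \<comment> \<open>The slope bound turns the loss \<open>u - l\<close> into a fraction
      \<open>1 / R\<close> of the image length.\<close>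
    have "R * (u - l) \<le> \<bar>crit u n - crit l n\<bar>" using that(3) lu by (simp add: expanding_def)
    then have "u - l \<le> \<bar>crit u n - crit l n\<bar> / R" using R by (simp add: le_divide_eq mult.commute)
    moreover have "p * \<bar>crit u n - crit l n\<bar> - (u - l) \<le> \<bar>crit u (Suc n) - crit l (Suc n)\<bar>"
      using that pq R by (intro expanding_Suc(2)[OF that(3)]) auto
    ultimately show "\<kappa> * \<bar>crit u n - crit l n\<bar> \<le> \<bar>crit u (Suc n) - crit l (Suc n)\<bar>"
      by (simp add: \<kappa> algebra_simps)
  qed
  define \<Delta> where "\<Delta> = \<bar>crit u n - crit l n\<bar>"
  have "0 \<le> \<Delta>" by (simp add: \<Delta>_def)
  have lu: "l < u" using ex by (simp add: expanding_def)
  show ?thesis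
  proof (cases "\<exists>z. l < z \<and> z < u \<and> crit z n = 0")
    case False
    then have "expanding l u (Suc n) R" "\<kappa> * \<Delta> \<le> \<bar>crit u (Suc n) - crit l (Suc n)\<bar>"
      using step[OF ex(1,2,4)] by (auto simp: \<Delta>_def)
    moreover have "min \<kappa> (\<kappa> * \<kappa> / 2) * \<Delta> \<le> \<kappa> * \<Delta>" using \<open>0 \<le> \<Delta>\<close> by (intro mult_right_mono) auto
    ultimately show ?thesis using ex by (intro exI[of _ l] exI[of _ u] exI[of _ "Suc n"]) (auto simp: \<Delta>_def)
  next
    case True
    then obtain z where z: "l < z" "z < u" "crit z n = 0" by blast
    have nz: "crit a n \<noteq> 0" if "a \<in> {l..u}" "a \<noteq> z" for a
      using expanding_nonzero[OF ex(4) R(1), of z a] z that by simp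
    have half: ?thesis if h: "l \<le> l'" "l' < u'" "u' \<le> u" "l' = z \<or> u' = z"
      "\<Delta> / 2 \<le> \<bar>crit u' n - crit l' n\<bar>" for l' u'
    proof -
      have pq': "p \<le> l'" "u' \<le> q" using h ex by auto
      have e0: "expanding l' u' n R" using expanding_subinterval[OF ex(4) h(1-3)] by simp
      have "crit a n \<noteq> 0" if "l' < a" "a < u'" for a using nz[of a] h that by auto
      note e1 = step[OF pq' e0 this]
      have "crit a (Suc n) \<noteq> 0" if a: "l' < a" "a < u'" for a
      proof
        assume "crit a (Suc n) = 0"
        moreover have "crit b t \<noteq> 0" if "0 < t" "t \<le> n" "b \<in> {min z a..max z a}" "b \<noteq> z" for b t
        proof -
          have "b \<in> {l<..<u}" using that a h z by (auto simp: min_def max_def split: if_splits)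
          then show ?thesis using nz[of b] that ex(4) by (cases "t = n") (auto simp: expanding_def)
        qed
        ultimately have "double_cut p q"
          unfolding double_cut_def using z ex a h
          by (intro exI[of _ n] exI[of _ z] exI[of _ a]) auto
        then show False using assms by simp
      qed
      note e2 = step[OF pq' conjunct1[OF e1] this]
      have "\<kappa> * \<kappa> / 2 * \<Delta> = \<kappa> * (\<kappa> * (\<Delta> / 2))" by simp
      also have "\<dots> \<le> \<kappa> * (\<kappa> * \<bar>crit u' n - crit l' n\<bar>)" using h(5) \<kappa> by (intro mult_left_mono) auto
      also have "\<dots> \<le> \<kappa> * \<bar>crit u' (Suc n) - crit l' (Suc n)\<bar>" using e1 \<kappa> by (intro mult_left_mono) auto
      also have "\<dots> \<le> \<bar>crit u' (Suc (Suc n)) - crit l' (Suc (Suc n))\<bar>" using e2 by blast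
      finally have "\<kappa> * \<kappa> / 2 * \<Delta> \<le> \<bar>crit u' (Suc (Suc n)) - crit l' (Suc (Suc n))\<bar>" .
      moreover have "min \<kappa> (\<kappa> * \<kappa> / 2) * \<Delta> \<le> \<kappa> * \<kappa> / 2 * \<Delta>" using \<open>0 \<le> \<Delta>\<close> by (intro mult_right_mono) auto
      ultimately show ?thesis using e2 pq'
        by (intro exI[of _ l'] exI[of _ u'] exI[of _ "Suc (Suc n)"]) (auto simp: \<Delta>_def)
    qed
    have "\<Delta> \<le> \<bar>crit z n - crit l n\<bar> + \<bar>crit u n - crit z n\<bar>" by (simp add: \<Delta>_def)
    then consider "\<Delta> / 2 \<le> \<bar>crit z n - crit l n\<bar>" | "\<Delta> / 2 \<le> \<bar>crit u n - crit z n\<bar>" by linarith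
    then show ?thesis using half[of l z] half[of z u] z by cases auto
  qed
qed

text \<open>
  Otherwise each interval can be halved at most at every other step, so it grows by a factor close to
  \<open>p * p / 2 > 1\<close> in two steps, beyond the size of the phase space.
\<close>

lemma double_cut_exists:
  assumes "sqrt 2 < p" "p < q" "q \<le> 2"
  shows "double_cut p q"
proof (rule ccontr)
  assume nd: "\<not> double_cut p q"
  have "1 < sqrt 2" by simp
  then have p: "1 < p" using assms by linarith
  \<comment> \<open>\<open>\<kappa>\<close> lies strictly between \<open>sqrt 2\<close> and
    \<open>p\<close>; \<open>R\<close> is so large that the slope bound persists and
    \<open>p - 1 / R\<close> is at least \<open>\<kappa>\<close>.\<close>
  define \<kappa> where "\<kappa> = (sqrt 2 + p) / 2"
  define R where "R = max (1 / (p - 1)) (1 / (p - \<kappa>))"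
  have \<kappa>: "sqrt 2 < \<kappa>" "\<kappa> < p" using assms by (auto simp: \<kappa>_def)
  have R: "1 / (p - 1) \<le> R" "1 / (p - \<kappa>) \<le> R" by (auto simp: R_def)
  have R_pos: "0 < R" using R(1) p by (smt (verit) divide_pos_pos)
  have R1: "R \<le> p * R - 1" using R(1) p by (simp add: divide_le_eq algebra_simps)
  define k where "k = p - 1 / R"
  have "1 / R \<le> p - \<kappa>" using R(2) R_pos \<kappa> by (simp add: divide_le_eq mult.commute)
  then have k: "\<kappa> \<le> k" by (simp add: k_def)
  then have k2: "sqrt 2 < k" using \<kappa> by simp
  have k1: "1 < k" using k2 \<open>1 < sqrt 2\<close> by linarith
  have "sqrt 2 * sqrt 2 < k * k" using k2 k1 by (intro mult_strict_mono) auto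
  then have "2 < k * k" by simp
  with k1 have \<theta>: "1 < min k (k * k / 2)" by simp
  obtain l u n where init: "p \<le> l" "u \<le> q" "0 < n" "expanding l u n R"
    using expanding_large[OF less_imp_le[OF assms(1)] assms(2,3)] by blast
  define \<Delta> where "\<Delta> = \<bar>crit u n - crit l n\<bar>"
  have "l < u" "R * (u - l) \<le> \<Delta>" using init by (auto simp: expanding_def \<Delta>_def)
  then have "0 < \<Delta>" using R_pos by (smt (verit) mult_pos_pos)
  have "\<exists>l u n. p \<le> l \<and> u \<le> q \<and> 0 < n \<and> expanding l u n R \<and>
      min k (k * k / 2) ^ j * \<Delta> \<le> \<bar>crit u n - crit l n\<bar>" for j
  proof (induction j)
    case 0
    show ?case using init by (auto simp: \<Delta>_def)
  next
    case (Suc j)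
    then obtain l u n where ih: "p \<le> l" "u \<le> q" "0 < n" "expanding l u n R"
      "min k (k * k / 2) ^ j * \<Delta> \<le> \<bar>crit u n - crit l n\<bar>" by blast
    obtain l' u' n' where *: "p \<le> l'" "u' \<le> q" "0 < n'" "expanding l' u' n' R"
      "min k (k * k / 2) * \<bar>crit u n - crit l n\<bar> \<le> \<bar>crit u' n' - crit l' n'\<bar>"
      using growth_step[OF p assms(3) R_pos R1 ih(1-4) nd k_def] k1 by auto
    have "min k (k * k / 2) * (min k (k * k / 2) ^ j * \<Delta>) \<le> min k (k * k / 2) * \<bar>crit u n - crit l n\<bar>"
      using ih(5) \<theta> by (intro mult_left_mono) auto
    then have "min k (k * k / 2) ^ Suc j * \<Delta> \<le> \<bar>crit u' n' - crit l' n'\<bar>"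
      using *(5) by (simp add: mult.assoc)
    then show ?case using * by blast
  qed
  moreover obtain j where "2 / \<Delta> < min k (k * k / 2) ^ j" using real_arch_pow[OF \<theta>] by blast
  then have "2 < min k (k * k / 2) ^ j * \<Delta>" using \<open>0 < \<Delta>\<close> by (simp add: divide_less_eq)
  ultimately obtain l u n where "p \<le> l" "u \<le> q" "expanding l u n R" "2 < \<bar>crit u n - crit l n\<bar>"
    by (meson order_less_le_trans)
  moreover from this have "l < u" by (simp add: expanding_def)
  ultimately have "\<bar>crit u n\<bar> \<le> 1" "\<bar>crit l n\<bar> \<le> 1" "2 < \<bar>crit u n - crit l n\<bar>"
    using p assms by (simp_all add: abs_crit_le_1)
  then show False by linarith
qed

section \<open>Orientation of the central branch and the first window\<close>

text \<open>The sign of the slope of the \<open>n\<close>-th iterate just to the right of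
  \<open>0\<close>. The leading minus is the step from \<open>0\<close> itself, where
  \<open>sgn\<close> vanishes.\<close>

definition orient :: "real \<Rightarrow> nat \<Rightarrow> real" where
  "orient a n = - (\<Prod>t\<in>{1..<n}. - sgn (crit a t))"

lemma orient_Suc: "0 < n \<Longrightarrow> orient a (Suc n) = - sgn (crit a n) * orient a n"
  by (cases n) (simp_all add: orient_def)

lemma orient_cases: "(\<And>t. 0 < t \<Longrightarrow> t < n \<Longrightarrow> crit a t \<noteq> 0) \<Longrightarrow> orient a n = 1 \<or> orient a n = -1"
proof (induction n)
  case (Suc n)
  show ?case
  proof (cases "n = 0")
    case False
    then have "sgn (crit a n) = 1 \<or> sgn (crit a n) = -1" using Suc.prems[of n] by (auto simp: sgn_real_def)
    then show ?thesis using Suc False by (auto simp: orient_Suc)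
  qed (simp add: orient_def)
qed (simp add: orient_def)

lemma sgn_crit_const:
  assumes "\<And>c. c \<in> {l..u} \<Longrightarrow> crit c t \<noteq> 0" "a \<in> {l..u}" "b \<in> {l..u}"
  shows "sgn (crit a t) = sgn (crit b t)"
proof -
  have "0 \<le> crit a t * crit b t"
    by (rule nonzero_same_sign[OF continuous_on_crit]) (use assms in auto)
  then show ?thesis using assms(1)[OF assms(2)] assms(1)[OF assms(3)]
    by (auto simp: sgn_real_def zero_le_mult_iff split: if_splits)
qed

lemma orient_const:
  assumes "\<And>c t. c \<in> {l..u} \<Longrightarrow> 0 < t \<Longrightarrow> t < n \<Longrightarrow> crit c t \<noteq> 0" "a \<in> {l..u}" "b \<in> {l..u}"
  shows "orient a n = orient b n"
proof -
  have "sgn (crit a t) = sgn (crit b t)" if "t \<in> {1..<n}" for t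
    using assms that by (intro sgn_crit_const) auto
  then show ?thesis by (simp add: orient_def)
qed

text \<open>
  The \<open>n\<close>-th iterate is unimodal near \<open>0\<close>, with a minimum or a maximum according to \<open>orient a n\<close>.
\<close>

lemma iter_eq_orient:
  assumes "0 \<le> a" "0 < n" "\<And>t. 0 < t \<Longrightarrow> t < n \<Longrightarrow> sgn ((normal_tent a ^^ t) x) = sgn (crit a t)"
  shows "(normal_tent a ^^ n) x = crit a n + orient a n * a ^ n * \<bar>x\<bar>"
  using assms(2,3)
proof (induction n rule: nat_induct_non_zero)
  case 1
  show ?case by (simp add: normal_tent_def orient_def)
next
  case (Suc n)
  let ?y = "(normal_tent a ^^ n) x" and ?s = "sgn (crit a n)"
  have "\<bar>?y\<bar> = ?s * ?y" using Suc.prems[of n] Suc.hyps by (metis abs_sgn lessI mult.commute)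
  moreover have "\<bar>crit a n\<bar> = ?s * crit a n" by (simp add: abs_sgn mult.commute)
  moreover have "?y = crit a n + orient a n * a ^ n * \<bar>x\<bar>" using Suc by simp
  ultimately show ?case
    unfolding normal_tent_iter_Suc crit_Suc orient_Suc[OF Suc.hyps] by (simp add: algebra_simps)
qed

text \<open>
  As the parameter runs through the interval, the \<open>n\<close>-th iterate moves between the turning point \<open>0\<close>
  and the fixed point \<open>1 / (a + 1)\<close>.
\<close>

definition spread :: "real \<Rightarrow> real \<Rightarrow> nat \<Rightarrow> bool" where
  "spread l u n \<longleftrightarrow> l < u \<and> 0 < n \<and>
    (\<forall>a\<in>{l..u}. (\<forall>t. 0 < t \<and> t < n \<longrightarrow> crit a t \<noteq> 0) \<and>
      0 \<le> crit a n * (a + 1) \<and> crit a n * (a + 1) \<le> 1) \<and>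
    (crit l n * (l + 1) = 0 \<and> crit u n * (u + 1) = 1 \<or> crit l n * (l + 1) = 1 \<and> crit u n * (u + 1) = 0)"

lemma spreadD:
  assumes "spread l u n"
  shows "l < u" "0 < n" "\<And>a t. a \<in> {l..u} \<Longrightarrow> 0 < t \<Longrightarrow> t < n \<Longrightarrow> crit a t \<noteq> 0"
    "\<And>a. a \<in> {l..u} \<Longrightarrow> 0 \<le> crit a n * (a + 1) \<and> crit a n * (a + 1) \<le> 1"
    "crit l n * (l + 1) = 0 \<and> crit u n * (u + 1) = 1 \<or> crit l n * (l + 1) = 1 \<and> crit u n * (u + 1) = 0"
  using assms by (simp_all add: spread_def)

text \<open>The ends \<open>z\<close> and \<open>z'\<close> of a double cut give the values
  \<open>z + 1 > 1\<close> and \<open>0\<close> of \<open>h\<close>. A crossing with values at most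
  \<open>1\<close> avoids \<open>z\<close>, so no earlier iterate vanishes on it.\<close>

lemma spread_exists:
  assumes "sqrt 2 < p" "p < q" "q \<le> 2"
  obtains l u n where "p \<le> l" "u \<le> q" "spread l u n"
proof -
  obtain n z z' where n: "0 < n" "z \<in> {p..q}" "z' \<in> {p..q}" "z \<noteq> z'" "crit z n = 0" "crit z' (Suc n) = 0"
    and nz: "\<And>a t. 0 < t \<Longrightarrow> t \<le> n \<Longrightarrow> a \<in> {min z z'..max z z'} \<Longrightarrow> a \<noteq> z \<Longrightarrow> crit a t \<noteq> 0"
    using double_cut_exists[OF assms] unfolding double_cut_def by blast
  have "1 < sqrt 2" by simp
  then have z_pos: "0 < z" using assms(1) n(2) by (simp, linarith)
  define h where "h a = crit a (Suc n) * (a + 1)" for a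
  have hz: "h z = z + 1" "h z' = 0" using n by (auto simp: h_def crit_Suc)
  obtain l u where lu: "min z z' \<le> l" "l < u" "u \<le> max z z'" "\<And>a. a \<in> {l..u} \<Longrightarrow> 0 \<le> h a \<and> h a \<le> 1"
    "h l = 0 \<and> h u = 1 \<or> h l = 1 \<and> h u = 0"
  proof (rule crossing_subinterval)
    show "continuous_on {min z z'..max z z'} h"
      unfolding h_def by (intro continuous_intros continuous_on_crit)
    show "h (min z z') \<le> 0 \<and> 1 \<le> h (max z z') \<or> 1 \<le> h (min z z') \<and> h (max z z') \<le> 0"
      using hz z_pos by (auto simp: min_def max_def)
  qed auto
  have "crit a t \<noteq> 0" if "a \<in> {l..u}" "0 < t" "t < Suc n" for a t
  proof (rule nz)
    show "a \<noteq> z" using lu(4)[OF that(1)] hz z_pos by auto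
  qed (use that lu in auto)
  then have "spread l u (Suc n)" using lu by (simp add: spread_def h_def)
  moreover have "p \<le> l" "u \<le> q" using lu n by auto
  ultimately show thesis using that by blast
qed

text \<open>
  A detour with itinerary right, right, left, right reverses the orientation. It exists because
  \<open>a * a > 2\<close>.
\<close>

lemma spread_flip:
  assumes "spread l u n" "sqrt 2 < l" "u \<le> 2"
  obtains l' u' where "l \<le> l'" "u' \<le> u" "spread l' u' (n + 4)"
    "\<And>a. a \<in> {l'..u'} \<Longrightarrow> orient a (n + 4) = - orient a n"
proof -
  note sp = spreadD[OF assms(1)]
  have a: "1 < a" "2 < a * a" if "a \<in> {l..u}" for a
  proof -
    have "1 < sqrt 2" by simp
    then show a1: "1 < a" using that assms(2) by (simp, linarith)
    have "sqrt 2 * sqrt 2 < a * a" using that assms a1 by (intro mult_strict_mono) auto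
    then show "2 < a * a" by simp
  qed
  \<comment> \<open>\<open>y\<close> is the value after the four steps of the detour, as a
    polynomial in \<open>a\<close> and \<open>crit a n\<close>; the signs that justify it are
    established below.\<close>
  define y where "y a = (a - 1) * (a - 1) * (a + 1) - a ^ 4 * crit a n" for a
  define h where "h a = y a * (a + 1)" for a
  have cont: "continuous_on {l..u} h"
    unfolding h_def y_def by (intro continuous_intros continuous_on_crit)
  have h0: "1 \<le> h a" if "a \<in> {l..u}" "crit a n * (a + 1) = 0" for a
  proof -
    have "crit a n = 0" using that a[OF that(1)] by simp
    then have "h a = (a * a - 1) * (a * a - 1)" by (simp add: h_def y_def algebra_simps)
    moreover have "1 * 1 \<le> (a * a - 1) * (a * a - 1)" using a[OF that(1)] by (intro mult_mono) auto
    ultimately show ?thesis by simp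
  qed
  have h1: "h a \<le> 0" if "a \<in> {l..u}" "crit a n * (a + 1) = 1" for a
  proof -
    have "h a = (a - 1) * (a - 1) * (a + 1) * (a + 1) - a ^ 4 * (crit a n * (a + 1))"
      by (simp add: h_def y_def algebra_simps)
    also have "\<dots> = (a - 1) * (a - 1) * (a + 1) * (a + 1) - a ^ 4" by (simp only: that(2) mult_1_right)
    also have "\<dots> = 1 - 2 * (a * a)" by (simp add: algebra_simps power4_eq_xxxx)
    finally show ?thesis using a[OF that(1)] by simp
  qed
  have hh: "h l \<le> 0 \<and> 1 \<le> h u \<or> 1 \<le> h l \<and> h u \<le> 0"
    using sp(1,5) h0[of l] h0[of u] h1[of l] h1[of u] by auto
  obtain l' u' where lu: "l \<le> l'" "l' < u'" "u' \<le> u" "\<And>a. a \<in> {l'..u'} \<Longrightarrow> 0 \<le> h a \<and> h a \<le> 1"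
    "h l' = 0 \<and> h u' = 1 \<or> h l' = 1 \<and> h u' = 0"
    using crossing_subinterval[OF less_imp_le[OF sp(1)] cont hh] by blast
  have steps: "0 < crit a n" "0 < crit a (n + 1)" "crit a (n + 2) < 0" "0 < crit a (n + 3)" "crit a (n + 4) = y a"
    if a': "a \<in> {l'..u'}" for a
  proof -
    have al: "a \<in> {l..u}" using a' lu by auto
    note a1 = a[OF al]
    define w where "w = crit a n"
    define z1 z2 z3 where "z1 = 1 - a * w" and "z2 = 1 - a * z1" and "z3 = 1 + a * z2"
    have y: "y a = 1 - a * z3"
      by (simp add: y_def z1_def z2_def z3_def w_def algebra_simps power4_eq_xxxx)
    have w: "0 \<le> w" "w * (a + 1) \<le> 1"
      using sp(4)[OF al] a1 by (auto simp: w_def zero_le_mult_iff)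
    have y_rng: "0 \<le> y a" "y a * (a + 1) \<le> 1" using lu(4)[OF a'] a1 by (auto simp: h_def zero_le_mult_iff)
    \<comment> \<open>The signs are recovered backwards from the bounds on
      \<open>y a\<close>.\<close>
    have z3: "0 < z3"
    proof -
      have "y a * (a + 1) < 1 * (a + 1)" by (rule le_less_trans[OF y_rng(2)]) (use a1 in simp)
      then have "y a < 1" by (rule mult_right_less_imp_less) (use a1 in simp)
      then show ?thesis using y a1 by (simp add: zero_less_mult_iff)
    qed
    have z3_le: "z3 < 1"
    proof (rule ccontr)
      assume "\<not> z3 < 1"
      then have "a * 1 \<le> a * z3" using a1 by (intro mult_left_mono) auto
      moreover have "a * z3 \<le> 1" using y y_rng by simp
      ultimately show False using a1(1) by linarith
    qed
    have z2: "z2 < 0" using z3_le a1 by (simp add: z3_def mult_less_0_iff)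
    have z1: "0 < z1"
    proof (rule zero_less_mult_pos)
      show "0 < a * z1" using z2 by (simp add: z2_def)
    qed (use a1 in simp)
    have w_pos: "0 < w"
    proof (rule ccontr)
      assume "\<not> 0 < w"
      then have "w = 0" using w by simp
      then have "y a * (a + 1) = (a * a - 1) * (a * a - 1)" by (simp add: y_def w_def algebra_simps)
      moreover have "1 < (a * a - 1) * (a * a - 1)" using a1 by (intro less_1_mult) auto
      ultimately show False using y_rng by simp
    qed
    have c: "crit a (n + 1) = z1" using w_pos by (simp add: crit_Suc z1_def w_def)
    have c2: "crit a (n + 2) = z2" using c z1 by (simp add: crit_Suc[of a "n + 1", simplified] z2_def)
    have c3: "crit a (n + 3) = z3"
      using c2 z2 crit_Suc[of a "n + 2"] by (simp add: z3_def eval_nat_numeral)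
    have c4: "crit a (n + 4) = y a"
      using c3 z3 crit_Suc[of a "n + 3"] y by (simp add: eval_nat_numeral)
    show "0 < crit a n" "0 < crit a (n + 1)" "crit a (n + 2) < 0" "0 < crit a (n + 3)" "crit a (n + 4) = y a"
      using w_pos z1 z2 z3 c c2 c3 c4 by (auto simp: w_def)
  qed
  have "crit a t \<noteq> 0" if t: "a \<in> {l'..u'}" "0 < t" "t < n + 4" for a t
  proof -
    consider "t < n" | "t = n" | "t = n + 1" | "t = n + 2" | "t = n + 3" using t by linarith
    then show ?thesis
      by cases (use t sp(3)[of a t] steps[OF t(1)] lu in auto)
  qed
  then have "spread l' u' (n + 4)"
    using lu steps(5)[of l'] steps(5)[of u'] steps(5) by (simp add: spread_def h_def)
  moreover have "orient a (n + 4) = - orient a n" if "a \<in> {l'..u'}" for a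
  proof -
    have "orient a (n + 4) = - sgn (crit a (n + 3)) * (- sgn (crit a (n + 2)) *
        (- sgn (crit a (n + 1)) * (- sgn (crit a n) * orient a n)))"
      using sp(2) orient_Suc[of "n + 3" a] orient_Suc[of "n + 2" a] orient_Suc[of "n + 1" a] orient_Suc[of n a]
      by (simp add: eval_nat_numeral)
    then show ?thesis using steps[OF that] by simp
  qed
  ultimately show thesis using that lu by blast
qed

lemma crit_margin:
  assumes "\<And>a t. a \<in> {l..u} \<Longrightarrow> 0 < t \<Longrightarrow> t < n \<Longrightarrow> crit a t \<noteq> 0"
  shows "\<exists>m>0. \<forall>a\<in>{l..u}. \<forall>t. 0 < t \<and> t < n \<longrightarrow> m \<le> \<bar>crit a t\<bar>"
  using assms
proof (induction n)
  case (Suc n)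
  then obtain m where m: "0 < m" "\<And>a t. a \<in> {l..u} \<Longrightarrow> 0 < t \<Longrightarrow> t < n \<Longrightarrow> m \<le> \<bar>crit a t\<bar>"
    by (metis less_Suc_eq)
  have "\<exists>m'>0. \<forall>a\<in>{l..u}. 0 < n \<longrightarrow> m' \<le> \<bar>crit a n\<bar>"
  proof (cases "0 < n \<and> {l..u} \<noteq> {}")
    case True
    moreover have "continuous_on {l..u} (\<lambda>a. \<bar>crit a n\<bar>)"
      by (intro continuous_intros continuous_on_crit)
    ultimately obtain b where "b \<in> {l..u}" "\<forall>a\<in>{l..u}. \<bar>crit b n\<bar> \<le> \<bar>crit a n\<bar>"
      using continuous_attains_inf[of "{l..u}" "\<lambda>a. \<bar>crit a n\<bar>"] by auto
    then show ?thesis using Suc.prems[of b n] True by (intro exI[of _ "\<bar>crit b n\<bar>"]) auto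
  qed (auto intro: exI[of _ 1])
  then obtain m' where m': "0 < m'" "\<And>a. a \<in> {l..u} \<Longrightarrow> 0 < n \<Longrightarrow> m' \<le> \<bar>crit a n\<bar>" by blast
  show ?case
  proof (intro exI[of _ "min m m'"] conjI ballI allI impI)
    fix a t assume "a \<in> {l..u}" "0 < t \<and> t < Suc n"
    then show "min m m' \<le> \<bar>crit a t\<bar>" using m(2)[of a t] m'(2)[of a] by (cases "t = n") auto
  qed (use m m' in auto)
qed (auto intro: exI[of _ 1])

text \<open>The base of the tower: the pole of the second iterate is the fixed point of the map
  itself.\<close>

lemma follows_2:
  assumes "1 < a" "e 1 = 1"
  shows "follows a 2 e 1" and "pole a 2 = 1 / (a + 1)"
proof -
  show pole: "pole a 2 = 1 / (a + 1)"
  proof -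
    have "a\<^sup>2 - 1 = (a - 1) * (a + 1)" by (simp add: algebra_simps power2_eq_square)
    then show ?thesis using assms(1) by (simp add: pole_def crit_2)
  qed
  show "follows a 2 e 1"
    unfolding follows_def
  proof (intro allI impI)
    fix x assume "\<bar>x\<bar> \<le> pole a 2"
    then have "\<bar>x\<bar> * (a + 1) \<le> 1" using assms by (simp add: pole le_divide_eq)
    then have *: "a * \<bar>x\<bar> \<le> 1 - \<bar>x\<bar>" by (simp add: algebra_simps)
    have "a * \<bar>x\<bar> < 1" using * by (cases "x = 0") auto
    then have pos: "0 < 1 - a * \<bar>x\<bar>" by simp
    have "(normal_tent a ^^ 2) x = crit a 2 + 1 * a ^ 2 * \<bar>x\<bar>"
      using normal_tent_iter_Suc[of 1 a x] pos unfolding crit_2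
      by (simp add: normal_tent_def numeral_2_eq_2 algebra_simps)
    moreover have "sgn ((normal_tent a ^^ t) x) = e t" if "0 < t" "t < 2" for t
    proof -
      have "t = 1" using that by simp
      then show ?thesis using pos assms(2) by (simp add: normal_tent_def)
    qed
    ultimately show "(\<forall>t. 0 < t \<and> t < 2 \<longrightarrow> sgn ((normal_tent a ^^ t) x) = e t) \<and>
        (normal_tent a ^^ 2) x = crit a 2 + 1 * a ^ 2 * \<bar>x\<bar>"
      by blast
  qed
qed

text \<open>
  After \<open>2 * m\<close> more steps near the fixed point the central branch of the new iterate is so short that it
  is controlled by the margin of the first \<open>n\<close> iterates from \<open>0\<close>.
\<close>

lemma initial_window:
  assumes pq: "sqrt 2 < p" "p < q" "q \<le> 2"
  obtains l u e N where "p \<le> l" "u \<le> q" "window l u e 2 N 1"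
proof -
  obtain l0 u0 n0 where 0: "p \<le> l0" "u0 \<le> q" "spread l0 u0 n0" using spread_exists[OF pq] by blast
  \<comment> \<open>A window with \<open>s = 1\<close> needs a maximum of the \<open>N\<close>-th
    iterate at \<open>0\<close>; a detour corrects the orientation where necessary.\<close>
  have "\<exists>l u n. p \<le> l \<and> u \<le> q \<and> spread l u n \<and> (\<forall>a\<in>{l..u}. orient a n = -1)"
  proof -
    have nz: "crit c t \<noteq> 0" if "c \<in> {l0..u0}" "0 < t" "t < n0" for c t
      using 0(3) that by (simp add: spread_def)
    have l0u0: "l0 \<le> u0" using 0(3) by (simp add: spread_def)
    have const: "orient a n0 = orient l0 n0" if "a \<in> {l0..u0}" for a
      using orient_const[OF nz that, where b = l0] l0u0 by simp
    consider "orient l0 n0 = 1" | "orient l0 n0 = -1" using orient_cases[of n0 l0] nz[of l0] l0u0 by auto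
    then show ?thesis
    proof cases
      case 1
      obtain l u where "l0 \<le> l" "u \<le> u0" "spread l u (n0 + 4)"
        "\<And>a. a \<in> {l..u} \<Longrightarrow> orient a (n0 + 4) = - orient a n0"
        using spread_flip[OF 0(3)] 0 pq by (smt (verit))
      then show ?thesis using 0 const 1
        by (intro exI[of _ l] exI[of _ u] exI[of _ "n0 + 4"]) auto
    next
      case 2
      then show ?thesis using 0 const by (intro exI[of _ l0] exI[of _ u0] exI[of _ n0]) auto
    qed
  qed
  then obtain l u n where lu: "p \<le> l" "u \<le> q" and sp: "spread l u n"
    and or: "\<And>a. a \<in> {l..u} \<Longrightarrow> orient a n = -1" by blast
  note sp' = spreadD[OF sp]
  obtain m0 where m0: "0 < m0" "\<And>a t. a \<in> {l..u} \<Longrightarrow> 0 < t \<Longrightarrow> t < n \<Longrightarrow> m0 \<le> \<bar>crit a t\<bar>"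
    using crit_margin[of l u n, OF sp'(3)] by metis
  define \<epsilon> where "\<epsilon> = m0 / 2 ^ n"
  have "0 < \<epsilon>" using m0 by (simp add: \<epsilon>_def)
  have s2: "1 < sqrt 2" by simp
  have a: "sqrt 2 < a" "1 < a" "2 < a\<^sup>2" "a \<le> 2" if "a \<in> {l..u}" for a
  proof -
    show s: "sqrt 2 < a" "a \<le> 2" using that lu pq by auto
    then show "1 < a" using s2 by linarith
    have "(sqrt 2)\<^sup>2 < a\<^sup>2" using s by (intro power_strict_mono) auto
    then show "2 < a\<^sup>2" by simp
  qed
  have near: "sgn ((normal_tent a ^^ t) x) = sgn (crit a t)" if "a \<in> {l..u}" "\<bar>x\<bar> < \<epsilon>" "0 < t" "t < n" for a x t
  proof -
    have "\<bar>(normal_tent a ^^ t) x - (normal_tent a ^^ t) 0\<bar> \<le> 2 ^ t * \<bar>x - 0\<bar>"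
      using a[OF that(1)] by (intro normal_tent_iter_lipschitz) auto
    also have "\<dots> \<le> 2 ^ n * \<bar>x\<bar>" using that by (simp add: mult_right_mono power_increasing)
    also have "\<dots> < 2 ^ n * \<epsilon>" using that by simp
    also have "\<dots> = m0" by (simp add: \<epsilon>_def)
    also have "m0 \<le> \<bar>crit a t\<bar>" using m0 that by simp
    finally show ?thesis by (auto simp: crit_def sgn_real_def split: if_splits)
  qed
  \<comment> \<open>From time \<open>n\<close> on the orbit turns around the fixed point on the
    positive side, hence the symbol \<open>1\<close>.\<close>
  define e where "e t = (if t < n then sgn (crit l t) else 1)" for t
  have e_crit: "sgn (crit a t) = e t" if "a \<in> {l..u}" "0 < t" "t < n" for a t
    using sgn_crit_const[of l u t a l] sp'(1,3) that by (simp add: e_def)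
  have e_1: "e 1 = 1" using sp'(2) by (simp add: e_def)
  \<comment> \<open>This makes the pole of the \<open>N\<close>-th iterate smaller than
    \<open>\<epsilon>\<close>; the additional \<open>4\<close> in \<open>m\<close> makes up for the
    \<open>1\<close> in \<open>\<mu> - 1\<close> and gives \<open>2 < \<mu>\<close>.\<close>
  obtain k where k: "1 / \<epsilon> < (sqrt 2) ^ k" using real_arch_pow[OF s2] by blast
  define m where "m = k + 4"
  define N where "N = n + 2 * m"
  define P w v where "P a = 1 / (a + 1)" and "w a = crit a n"
    and "v a = P a - (a\<^sup>2) ^ m * (P a - w a)" for a :: real
  have P: "0 < P a" "P a < 1" if "a \<in> {l..u}" for a using a[OF that] by (auto simp: P_def)
  have wP: "0 \<le> w a" "w a \<le> P a" if "a \<in> {l..u}" for a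
    using sp'(4)[OF that] a(2)[OF that] by (auto simp: w_def P_def zero_le_mult_iff le_divide_eq)
  have v_low: "v a \<le> 0" if "a \<in> {l..u}" "w a = 0" for a
    using one_le_power[of "a\<^sup>2" m] a[OF that(1)] P[OF that(1)] that(2)
    by (simp add: v_def mult_le_cancel_right1)
  have v_high: "v a = P a" if "w a = P a" for a using that by (simp add: v_def)
  have w_ends: "w l = 0 \<and> w u = P u \<or> w l = P l \<and> w u = 0"
    using sp'(5) a[of l] a[of u] sp'(1) by (auto simp: w_def P_def eq_divide_eq)
  obtain l' u' where lu': "l \<le> l'" "l' < u'" "u' \<le> u" "\<And>b. b \<in> {l'..u'} \<Longrightarrow> 0 \<le> v b / P b \<and> v b / P b \<le> 1"
    "v l' / P l' = 0 \<and> v u' / P u' = 1 \<or> v l' / P l' = 1 \<and> v u' / P u' = 0"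
  proof (rule crossing_subinterval)
    show "continuous_on {l..u} (\<lambda>a. v a / P a)"
      unfolding v_def P_def w_def using a by (force intro!: continuous_intros continuous_on_crit)
    show "v l / P l \<le> 0 \<and> 1 \<le> v u / P u \<or> 1 \<le> v l / P l \<and> v u / P u \<le> 0"
      using w_ends sp'(1) P[of l] P[of u] v_low[of l] v_low[of u] v_high[of l] v_high[of u]
      by (auto simp: divide_le_0_iff)
  qed (use sp' in auto)
  have step: "(\<forall>t. 0 < t \<and> t < N \<longrightarrow> sgn (crit b t) = e t) \<and> follows b 2 e 1 \<and> follows b N e (- 1) \<and>
      crit b N = v b \<and> pole b 2 = P b \<and> 0 \<le> v b \<and> v b \<le> P b" if b': "b \<in> {l'..u'}" for b
  proof -
    have b: "b \<in> {l..u}" using b' lu' by auto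
    note a = a[OF b] and P = P[OF b] and wP = wP[OF b]
    have v: "0 \<le> v b" "v b \<le> P b" using lu'(4)[OF b'] P by (auto simp: zero_le_divide_iff)
    note f2 = follows_2[where e = e, OF a(2) e_1]
    have pole2: "pole b 2 = P b" using f2 by (simp add: P_def)
    define L where "L = b\<^sup>2"
    have L: "2 < L" using a by (simp add: L_def)
    define \<mu> where "\<mu> = b ^ N"
    have bN: "\<mu> = L ^ m * b ^ n" by (simp add: \<mu>_def N_def L_def power_add power_mult)
    have \<mu>: "2 < \<mu>" "1 / \<epsilon> < \<mu> - 1"
    proof -
      have "(sqrt 2) ^ k * 4 = (sqrt 2) ^ (k + 4)" by (simp add: power_add power4_eq_xxxx)
      also have "\<dots> \<le> b ^ (k + 4)" using a by (intro power_mono) auto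
      also have "\<dots> \<le> \<mu>" unfolding \<mu>_def using a by (intro power_increasing) (auto simp: N_def m_def)
      finally have "(sqrt 2) ^ k * 4 \<le> \<mu>" .
      moreover have "1 \<le> (sqrt 2) ^ k" by simp
      ultimately show "2 < \<mu>" "1 / \<epsilon> < \<mu> - 1" using k by linarith+
    qed
    \<comment> \<open>The first \<open>m - 1\<close> laps end to the right of \<open>0\<close>; the
      last lap is split off because it may end at a negative value.\<close>
    have "Suc (m - 1) = m" by (simp add: m_def)
    then have Lm: "L ^ m = L * L ^ (m - 1)" using power_Suc[of L "m - 1"] by (simp only:)
    have crit2: "crit b 2 = - 1 * \<bar>crit b 2\<bar>" using a by (simp add: crit_2)
    have claim: "(\<forall>t. 0 < t \<and> t < N \<longrightarrow> sgn ((normal_tent b ^^ t) x) = e t) \<and>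
        (normal_tent b ^^ N) x = v b - \<mu> * \<bar>x\<bar>"
      if x: "\<bar>x\<bar> < \<epsilon>" "P b - v b + \<mu> * \<bar>x\<bar> < L * P b" for x
    proof -
      define v0 where "v0 = w b - b ^ n * \<bar>x\<bar>"
      have xn: "(normal_tent b ^^ n) x = 1 * v0"
        using iter_eq_orient[of b n x] near[OF b x(1)] a sp'(2) or[OF b] by (simp add: v0_def w_def)
      have "0 \<le> b ^ n * \<bar>x\<bar>" using a by simp
      then have v0: "v0 \<le> pole b 2" using wP pole2 by (simp add: v0_def)
      have eq: "L * (L ^ (m - 1) * (P b - v0)) = P b - v b + \<mu> * \<bar>x\<bar>"
        by (simp add: v_def v0_def bN Lm algebra_simps flip: L_def)
      have "L * (L ^ (m - 1) * (P b - v0)) < L * P b" using x(2) eq by simp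
      then have pos: "0 < P b - L ^ (m - 1) * (P b - v0)" using L by simp
      then have pos': "0 \<le> pole b 2 - (b\<^sup>2) ^ (m - 1) * (pole b 2 - v0)" by (simp add: pole2 L_def)
      note laps = follows_laps[OF f2(1) disjI1[OF refl] less_trans[OF _ a(3)] crit2 v0 pos', simplified]
      have iter: "(normal_tent b ^^ (n + t)) x = (normal_tent b ^^ t) v0" for t
        using xn by (simp add: add.commute[of n] funpow_add)
      have "(normal_tent b ^^ N) x = v b - \<mu> * \<bar>x\<bar>"
      proof -
        let ?z = "P b - L ^ (m - 1) * (P b - v0)"
        have z: "(normal_tent b ^^ ((m - 1) * 2)) v0 = ?z" using laps(1)[of "m - 1"] by (simp add: pole2 L_def)
        have "L ^ (m - 1) * (P b - v0) \<ge> 0" using L v0 pole2 by simp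
        then have "\<bar>?z\<bar> \<le> pole b 2" using pos pole2 by simp
        then have "(normal_tent b ^^ 2) ?z = crit b 2 + L * ?z"
          using f2(1) pos by (simp add: follows_def L_def)
        moreover have "crit b 2 = P b - L * P b"
          using a by (simp add: crit_2 P_def L_def field_simps power2_eq_square)
        ultimately have "(normal_tent b ^^ 2) ?z = v b - \<mu> * \<bar>x\<bar>" using eq by (simp add: algebra_simps)
        moreover have "N = n + (2 + (m - 1) * 2)" by (simp add: N_def m_def)
        ultimately show ?thesis using iter[of "2 + (m - 1) * 2"] z by (simp only: funpow_add o_apply)
      qed
      moreover have "sgn ((normal_tent b ^^ t) x) = e t" if t: "0 < t" "t < N" for t
      proof (cases "t < n")
        case True
        then show ?thesis using near[OF b x(1)] e_crit[OF b] t by simp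
      next
        case False
        define j where "j = (t - n) div 2"
        have j: "j \<le> m - 1" using t False by (auto simp: j_def N_def m_def)
        have j2: "t - n = j * 2 \<or> t - n = j * 2 + 1" unfolding j_def by presburger
        have it: "(normal_tent b ^^ t) x = (normal_tent b ^^ (t - n)) v0" using iter[of "t - n"] False by simp
        have "sgn ((normal_tent b ^^ t) x) = 1"
          using j2
        proof
          assume "t - n = j * 2"
          moreover have "0 < P b - L ^ j * (P b - v0)" using laps(2)[of j] j pos by (simp add: pole2 L_def)
          ultimately show ?thesis using it laps(1)[of j] j by (simp add: pole2 L_def)
        next
          assume "t - n = j * 2 + 1"
          then show ?thesis using it laps(4)[of j 1] j e_1 by simp
        qed
        then show ?thesis using False by (simp add: e_def)
      qed
      ultimately show ?thesis by blast
    qed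
    have c0: "(\<forall>t. 0 < t \<and> t < N \<longrightarrow> sgn (crit b t) = e t) \<and> crit b N = v b"
    proof -
      have "P b - v b + \<mu> * \<bar>0\<bar> < L * P b"
      proof -
        have "1 * P b < L * P b" using L P by (intro mult_strict_right_mono) auto
        then show ?thesis using v by simp
      qed
      from claim[OF _ this] \<open>0 < \<epsilon>\<close> show ?thesis by (simp add: crit_def)
    qed
    moreover have "follows b N e (- 1)"
      unfolding follows_def
    proof (intro allI impI)
      fix x assume "\<bar>x\<bar> \<le> pole b N"
      then have x: "\<bar>x\<bar> * (\<mu> - 1) \<le> v b"
        using c0 v \<mu> by (simp add: pole_def le_divide_eq flip: \<mu>_def)
      have x1: "\<bar>x\<bar> < \<epsilon>"
      proof (rule ccontr)
        assume "\<not> \<bar>x\<bar> < \<epsilon>"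
        then have "\<epsilon> * (1 / \<epsilon>) < \<bar>x\<bar> * (\<mu> - 1)" using \<mu> \<open>0 < \<epsilon>\<close> by (intro mult_le_less_imp_less) auto
        then show False using x v P \<open>0 < \<epsilon>\<close> by simp
      qed
      have "\<bar>x\<bar> * 1 \<le> \<bar>x\<bar> * (\<mu> - 1)" using \<mu> by (intro mult_left_mono) auto
      then have "P b - v b + \<mu> * \<bar>x\<bar> \<le> P b + v b" using x by (simp add: algebra_simps)
      also have "\<dots> \<le> 2 * P b" using v by simp
      \<comment> \<open>Here \<open>sqrt 2 < b\<close> is used, in the form
        \<open>2 < L\<close>.\<close>
      also have "\<dots> < L * P b" using L P by (intro mult_strict_right_mono) auto
      finally show "(\<forall>t. 0 < t \<and> t < N \<longrightarrow> sgn ((normal_tent b ^^ t) x) = e t) \<and>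
          (normal_tent b ^^ N) x = crit b N + - 1 * b ^ N * \<bar>x\<bar>"
        using claim[OF x1] c0 by (simp add: \<mu>_def)
    qed
    ultimately show ?thesis using f2(1) pole2 v by blast
  qed
  have "e t \<noteq> 0" if "0 < t" "t < N" for t
    using that sp'(3)[of l t] sp'(1) by (auto simp: e_def sgn_zero_iff)
  moreover have "e 2 = - 1"
  proof -
    have l'_in: "l' \<in> {l'..u'}" "l' \<in> {l..u}" using lu' by auto
    have "sgn (crit l' 2) = e 2" using step[OF l'_in(1)] by (simp add: N_def m_def)
    moreover have "crit l' 2 < 0" using a[OF l'_in(2)] by (simp add: crit_2)
    ultimately show ?thesis by simp
  qed
  moreover have "crit l' N = 0 \<and> 1 * crit u' N = pole u' 2 \<or> crit u' N = 0 \<and> 1 * crit l' N = pole l' 2"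
  proof -
    have in': "l' \<in> {l'..u'}" "u' \<in> {l'..u'}" "l' \<in> {l..u}" "u' \<in> {l..u}" using lu' by auto
    show ?thesis
      using lu'(5) step[OF in'(1)] step[OF in'(2)] P[OF in'(3)] P[OF in'(4)] by auto
  qed
  moreover have "sqrt 2 \<le> l'" "u' \<le> 2" using lu lu' pq by auto
  ultimately have "window l' u' e 2 N 1"
    unfolding window_def using step lu'(2) by (auto simp: N_def m_def)
  then show thesis using that[of l' u'] lu lu' by auto
qed

section \<open>Uncountably many parameters\<close>

fun levels :: "nat \<Rightarrow> (nat \<Rightarrow> nat) \<Rightarrow> nat \<Rightarrow> nat" where
  "levels n r 0 = 2"
| "levels n r (Suc 0) = n"
| "levels n r (Suc (Suc i)) = 2 * levels n r (Suc i) + r i * levels n r (Suc i) * levels n r i"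

text \<open>Stage \<open>i\<close> describes the signs at positive times below
  \<open>levels n r (Suc i)\<close>; its later values carry no information.\<close>

primrec level_word :: "(nat \<Rightarrow> real) \<Rightarrow> nat \<Rightarrow> (nat \<Rightarrow> nat) \<Rightarrow> nat \<Rightarrow> nat \<Rightarrow> real" where
  "level_word e n r 0 = e"
| "level_word e n r (Suc i) =
    ext_word (levels n r i) (levels n r (Suc i)) (r i * levels n r (Suc i)) ((- 1) ^ i) (level_word e n r i)"

lemma nested_intervals:
  fixes l u :: "nat \<Rightarrow> real"
  assumes "\<And>i. l i \<le> l (Suc i)" "\<And>i. u (Suc i) \<le> u i" "\<And>i. l i \<le> u i"
  obtains x where "\<And>i. x \<in> {l i..u i}"
proof -
  have l: "l i \<le> l j" and u: "u j \<le> u i" if "i \<le> j" for i j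
    using that assms lift_Suc_mono_le[of l] lift_Suc_antimono_le[of u] by blast+
  have lu: "l i \<le> u j" for i j
    using l[of i "max i j"] u[of j "max i j"] assms(3)[of "max i j"] by simp
  have "bdd_above (range l)" using lu by (intro bdd_aboveI[of _ "u 0"]) auto
  then have "l i \<le> Sup (range l)" for i by (intro cSup_upper) auto
  moreover have "Sup (range l) \<le> u i" for i using lu by (intro cSup_least) auto
  ultimately show thesis using that[of "Sup (range l)"] by simp
qed

text \<open>\<open>window_step\<close> is iterated with \<open>r i * levels n r (Suc i)\<close> laps
  on alternating sides. A common point of the nested closed windows has the prescribed
  itinerary.\<close>

lemma renorm_tent_exists:
  assumes win: "window l u e 2 n 1" and r: "\<And>i. 0 < r i"
  obtains a where "a \<in> {l..u}" "renorm_tent (levels n r) r a"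
proof -
  let ?D = "levels n r" and ?W = "level_word e n r"
  define Q where "Q x y \<longleftrightarrow> fst x \<le> fst y \<and> snd y \<le> snd x" for x y :: "real \<times> real"
  define win_at where "win_at i x \<longleftrightarrow> window (fst x) (snd x) (?W i) (?D i) (?D (Suc i)) ((- 1) ^ i) \<and>
    Q (l, u) x" for i x
  have "\<exists>f. \<forall>i. win_at i (f i) \<and> Q (f i) (f (Suc i))"
  proof (rule dependent_nat_choice)
    show "\<exists>x. win_at 0 x" using win by (auto simp: win_at_def Q_def)
  next
    fix x i
    assume x: "win_at i x"
    then have w: "window (fst x) (snd x) (?W i) (?D i) (?D (Suc i)) ((- 1) ^ i)" by (simp add: win_at_def)
    then have "0 < r i * ?D (Suc i)" using r by (auto simp: window_def)
    from window_step[OF w this] obtain l' u' where "fst x \<le> l'" "u' \<le> snd x"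
      "window l' u' (?W (Suc i)) (?D (Suc i)) (?D (Suc (Suc i))) ((- 1) ^ Suc i)"
      by (auto simp: ac_simps)
    then show "\<exists>y. win_at (Suc i) y \<and> Q x y"
      using x by (intro exI[of _ "(l', u')"]) (auto simp: win_at_def Q_def)
  qed
  then obtain f where f: "\<And>i. win_at i (f i)" "\<And>i. Q (f i) (f (Suc i))" by blast
  have w: "window (fst (f i)) (snd (f i)) (?W i) (?D i) (?D (Suc i)) ((- 1) ^ i)" for i
    using f(1)[of i] by (simp add: win_at_def)
  obtain a where a: "\<And>i. a \<in> {fst (f i)..snd (f i)}"
    by (rule nested_intervals[of "fst \<circ> f" "snd \<circ> f"])
      (use f(2) w in \<open>auto simp: Q_def window_def intro: less_imp_le\<close>)
  have D: "0 < ?D i" "?D i < ?D (Suc i)" for i using w[of i] by (auto simp: window_def)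
  have mono_D: "strict_mono ?D" using D by (simp add: strict_mono_Suc_iff)
  have sgn_crit: "sgn (crit a t) = ?W i t" if "0 < t" "t < ?D (Suc i)" for i t
    using w[of i] a[of i] that by (simp add: window_def)
  have crit_nz: "crit a t \<noteq> 0" if "0 < t" for t
  proof -
    have "t < ?D (Suc t)"
      using strict_mono_imp_increasing[OF mono_D, of "Suc t"] by simp
    then show ?thesis using sgn_crit[of t t] w[of t] that by (auto simp: window_def)
  qed
  note ext = ext_word_simps[OF D(1) D(2)]
  have le_next: "?D (Suc i) + j * ?D i < ?D (Suc (Suc i))"
    if "j \<le> r i * ?D (Suc i)" for i j
    unfolding levels.simps using mult_le_mono1[OF that, of "?D i"] D(1)[of "Suc i"] by linarith
  have "renorm_tent ?D r a"
  proof unfold_locales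
    have a0: "a \<in> {l..u}" using a[of 0] f(1)[of 0] by (auto simp: win_at_def Q_def)
    have "1 < sqrt 2" by simp
    moreover have "sqrt 2 \<le> a" using a0 win by (simp add: window_def)
    ultimately show "1 < a" by linarith
    show "a \<le> 2" using a0 win by (simp add: window_def)
    show "?D 0 = 2" by simp
    show "2 < ?D (Suc 0)" using D(2)[of 0] by simp
    show "0 < r i" for i by (rule r)
    show "?D (Suc (Suc i)) = 2 * ?D (Suc i) + r i * ?D (Suc i) * ?D i" for i by simp
    show "sgn (crit a 1) = 1" by simp
    show "sgn (crit a (?D i)) = - ((- 1) ^ i)" for i
      using sgn_crit[of "?D i" i] D w[of i] by (simp add: window_def)
    show "sgn (crit a (?D (Suc i) + j * ?D i)) = (- 1) ^ i" if "j \<le> r i * ?D (Suc i)" for i j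
      using sgn_crit[of "?D (Suc i) + j * ?D i" "Suc i"] le_next[OF that] D(1)[of "Suc i"]
        ext(2)[OF that] by simp
    show "sgn (crit a (?D (Suc i) + j * ?D i + t)) = sgn (crit a t)"
      if "j < r i * ?D (Suc i)" "0 < t" "t < ?D i" for i j t
    proof -
      have "?D (Suc i) + j * ?D i + t < ?D (Suc (Suc i))"
        using le_next[of "Suc j" i] that by simp
      then have "sgn (crit a (?D (Suc i) + j * ?D i + t)) = ?W i t"
        using sgn_crit[of "?D (Suc i) + j * ?D i + t" "Suc i"] that ext(3)[OF that] by simp
      then show ?thesis using sgn_crit[of t i] that D(2)[of i] by simp
    qed
    show "sgn (crit a (?D (Suc i) + r i * ?D (Suc i) * ?D i + t)) = sgn (crit a t)"
      if "0 < t" "t < ?D (Suc i)" for i t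
    proof -
      have "sgn (crit a (?D (Suc i) + r i * ?D (Suc i) * ?D i + t)) = ?W i t"
        using sgn_crit[of "?D (Suc i) + r i * ?D (Suc i) * ?D i + t" "Suc i"] that
          ext_word_simps(4)[OF D(1)[of i] D(2)[of i] that(1), where M = "r i * ?D (Suc i)"] by simp
      then show ?thesis using sgn_crit[of t i] that by simp
    qed
    show "crit a t \<noteq> 0" if "0 < t" for t using crit_nz that .
  qed
  moreover have "a \<in> {l..u}" using a[of 0] f(1)[of 0] by (auto simp: win_at_def Q_def)
  ultimately show thesis using that by blast
qed

text \<open>At the first \<open>k\<close> where \<open>r\<close> and \<open>r'\<close> differ, the
  lengths up to \<open>Suc k\<close> still agree. One lap length after its last pole, the word with
  fewer laps shows the symbol of \<open>e_N\<close>, where the other word has a further pole with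
  the opposite symbol.\<close>

lemma renorm_tent_inj:
  assumes "renorm_tent (levels n r) r a" "renorm_tent (levels n r') r' a"
    and r: "\<And>i. r i \<in> {1, 2}" "\<And>i. r' i \<in> {1, 2}"
  shows "r = r'"
proof (rule ccontr)
  assume "r \<noteq> r'"
  then have "\<exists>i. r i \<noteq> r' i" by auto
  then obtain k where k: "r k \<noteq> r' k" and below: "\<And>i. i < k \<Longrightarrow> r i = r' i"
    unfolding exists_least_iff[of "\<lambda>i. r i \<noteq> r' i"] by blast
  have "i \<le> Suc k \<Longrightarrow> levels n r i = levels n r' i" for i
  proof (induction i rule: less_induct)
    case (less i)
    consider "i = 0" | "i = Suc 0" | j where "i = Suc (Suc j)" by (metis not0_implies_Suc)
    then show ?case by cases (use less below in simp_all)
  qed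
  from this[of k] this[of "Suc k"]
  have eq: "levels n r k = levels n r' k" "levels n r (Suc k) = levels n r' (Suc k)" by simp_all
  have False if A: "renorm_tent (levels n s) s a" and B: "renorm_tent (levels n s') s' a"
    and "s k = 1" "s' k = 2" "levels n s k = levels n s' k" "levels n s (Suc k) = levels n s' (Suc k)" for s s'
  proof -
    interpret A: renorm_tent "levels n s" s a by (rule A)
    interpret B: renorm_tent "levels n s'" s' a by (rule B)
    let ?d = "levels n s k" and ?N = "levels n s (Suc k)"
    have "sgn (crit a (?N + ?N * ?d + ?d)) = sgn (crit a ?d)"
      using A.e_return[of ?d k] A.N_gt_1[of k] A.N_less_Suc[of k] that by simp
    moreover have "sgn (crit a ?d) = - ((- 1) ^ k)" by (rule A.e_N)
    moreover have "sgn (crit a (?N + Suc ?N * ?d)) = (- 1) ^ k"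
      using B.e_pole[of "Suc ?N" k] A.N_gt_1[of "Suc k"] that by simp
    moreover have "?N + Suc ?N * ?d = ?N + ?N * ?d + ?d" by simp
    ultimately have "(- 1) ^ k = (- ((- 1) ^ k) :: real)" by (simp only:)
    then show False by simp
  qed
  note contra = this
  have "r k = 1 \<and> r' k = 2 \<or> r k = 2 \<and> r' k = 1" using r(1)[of k] r(2)[of k] k by auto
  then show False
    using contra[OF assms(1,2)] contra[OF assms(2,1)] eq by metis
qed

section \<open>From the critical orbit to the limit set\<close>

text \<open>The closures of the tails of the orbit are nested compact sets, each mapped onto the
  next. Injectivity lets the image commute with their intersection, so the limit set is mapped onto
  itself, and a continuous bijection of a compact set is a homeomorphism.\<close>

lemma omega_limit_homeomorphism:
  fixes f :: "'a::heine_borel \<Rightarrow> 'a"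
  assumes cont: "continuous_on UNIV f" and bnd: "bounded (range (\<lambda>n. (f ^^ n) x))"
    and inj: "inj_on f (closure ((\<lambda>n. (f ^^ n) x) ` {1..}))"
  shows "\<exists>g. homeomorphism (omega_limit f x) (omega_limit f x) f g"
proof -
  define K where "K i = closure ((\<lambda>n. (f ^^ n) x) ` {i..})" for i
  have omega: "omega_limit f x = (\<Inter>i. K i)"
    by (simp add: omega_limit_def K_def UNION_singleton_eq_range)
  have compact: "compact (K i)" for i
    unfolding K_def compact_closure using bnd by (rule bounded_subset) auto
  have anti: "K j \<subseteq> K i" if "i \<le> j" for i j
    unfolding K_def using that by (intro closure_mono image_mono) auto
  have image: "f ` K i = K (Suc i)" for i
  proof
    have "f ` (\<lambda>n. (f ^^ n) x) ` {i..} = (\<lambda>n. (f ^^ n) x) ` Suc ` {i..}"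
      by (simp add: image_image)
    also have "Suc ` {i..} = {Suc i..}"
    proof (intro equalityI subsetI)
      fix y assume "y \<in> {Suc i..}"
      then have "y = Suc (y - 1)" "y - 1 \<in> {i..}" by auto
      then show "y \<in> Suc ` {i..}" by (rule image_eqI)
    qed auto
    finally have orbit: "f ` (\<lambda>n. (f ^^ n) x) ` {i..} = (\<lambda>n. (f ^^ n) x) ` {Suc i..}" .
    have cont_i: "continuous_on (K i) f" using cont by (rule continuous_on_subset) simp
    show "f ` K i \<subseteq> K (Suc i)"
      unfolding K_def orbit[symmetric]
      using cont_i by (intro image_closure_subset closure_subset) (simp_all add: K_def)
    show "K (Suc i) \<subseteq> f ` K i"
      unfolding K_def[of "Suc i"] orbit[symmetric]
    proof (rule closure_minimal)
      show "f ` (\<lambda>n. (f ^^ n) x) ` {i..} \<subseteq> f ` K i"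
        unfolding K_def by (intro image_mono closure_subset)
      show "closed (f ` K i)"
        using compact_continuous_image[OF cont_i compact] by (rule compact_imp_closed)
    qed
  qed
  have shift: "(\<Inter>i. L (Suc i)) = (\<Inter>i. L i)" if "\<And>i. L (Suc i) \<subseteq> L i" for L :: "nat \<Rightarrow> 'a set"
  proof
    show "(\<Inter>i. L (Suc i)) \<subseteq> (\<Inter>i. L i)"
    proof (rule INT_greatest)
      fix j
      have "(\<Inter>i. L (Suc i)) \<subseteq> L (Suc j)" by (rule INT_lower) simp
      also have "\<dots> \<subseteq> L j" by (rule that)
      finally show "(\<Inter>i. L (Suc i)) \<subseteq> L j" .
    qed
    show "(\<Inter>i. L i) \<subseteq> (\<Inter>i. L (Suc i))" by (intro INT_greatest INT_lower) simp
  qed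
  have omega1: "omega_limit f x = (\<Inter>i. K (Suc i))"
    unfolding omega by (rule shift[symmetric]) (simp add: anti)
  have "f ` (\<Inter>i. K (Suc i)) = (\<Inter>i. f ` K (Suc i))"
  proof (rule image_INT)
    show "inj_on f (K 1)" using inj by (simp add: K_def)
    show "\<forall>i\<in>UNIV. K (Suc i) \<subseteq> K 1" using anti by simp
  qed simp
  also have "\<dots> = (\<Inter>i. K (Suc (Suc i)))" by (simp add: image)
  also have "\<dots> = (\<Inter>i. K (Suc i))" by (rule shift) (simp add: anti)
  finally have img: "f ` omega_limit f x = omega_limit f x" by (simp add: omega1)
  have sub: "omega_limit f x \<subseteq> K 1" by (auto simp: omega)
  have comp: "compact (omega_limit f x)"
    unfolding omega using compact by (intro compact_Inter) auto
  have "inj_on f (K 1)" using inj by (simp add: K_def)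
  then have "inj_on f (omega_limit f x)" using sub by (rule inj_on_subset)
  with homeomorphism_compact[OF comp continuous_on_subset[OF cont subset_UNIV] img]
  show ?thesis by blast
qed

lemma tent_map_eq:
  assumes "0 \<le> a"
  shows "tent_map a x = a * (1 / 2 - \<bar>x - 1 / 2\<bar>)"
proof (cases "x \<le> 1 / 2")
  case True
  then have "a * x \<le> a * (1 - x)" using assms by (intro mult_left_mono) auto
  then show ?thesis using True by (simp add: tent_map_def)
next
  case False
  then have "a * (1 - x) \<le> a * x" using assms by (intro mult_left_mono) auto
  then show ?thesis using False by (simp add: tent_map_def algebra_simps)
qed

lemma tent_map_orbit:
  assumes "1 \<le> a"
  shows "(tent_map a ^^ n) (1 / 2) = 1 / 2 + (a - 1) / 2 * crit a n"
proof (induction n)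
  case (Suc n)
  have "(tent_map a ^^ Suc n) (1 / 2) = tent_map a (1 / 2 + (a - 1) / 2 * crit a n)" using Suc by simp
  also have "\<dots> = a * (1 / 2 - \<bar>(a - 1) / 2 * crit a n\<bar>)" using assms by (subst tent_map_eq) simp_all
  also have "\<bar>(a - 1) / 2 * crit a n\<bar> = (a - 1) / 2 * \<bar>crit a n\<bar>" using assms by (simp add: abs_mult)
  finally show ?case by (simp add: crit_Suc field_simps)
qed simp

text \<open>Two points with equal image are equal or symmetric about \<open>1 / 2\<close>. Rescaled
  to the normal form, the latter are limits \<open>x\<close> and \<open>-x\<close> of the critical
  orbit, which forces \<open>x = 0\<close>.\<close>

lemma renorm_tent_homeomorphism:
  assumes "renorm_tent N r a"
  shows "\<exists>g. homeomorphism (omega_limit (tent_map a) (1 / 2)) (omega_limit (tent_map a) (1 / 2)) (tent_map a) g"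
proof (rule omega_limit_homeomorphism)
  interpret renorm_tent N r a by fact
  define b where "b = (a - 1) / 2"
  have b: "0 < b" using a_gt_1 by (simp add: b_def)
  have orbit: "(tent_map a ^^ n) (1 / 2) = 1 / 2 + b * crit a n" for n
    using tent_map_orbit a_gt_1 by (simp add: b_def)
  show "continuous_on UNIV (tent_map a)"
    unfolding tent_map_def by (intro continuous_intros)
  show "bounded (range (\<lambda>n. (tent_map a ^^ n) (1 / 2)))"
  proof (rule boundedI)
    fix x assume "x \<in> range (\<lambda>n. (tent_map a ^^ n) (1 / 2))"
    then obtain n where x: "x = 1 / 2 + b * crit a n" using orbit by auto
    have "\<bar>b * crit a n\<bar> \<le> b"
      using abs_crit_le_1[of a n] a_gt_1 a_le_2 b by (simp add: abs_mult)
    then show "norm x \<le> 1 / 2 + b" unfolding x real_norm_def by linarith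
  qed
  show "inj_on (tent_map a) (closure ((\<lambda>n. (tent_map a ^^ n) (1 / 2)) ` {1..}))" (is "inj_on _ ?C")
  proof (rule inj_onI)
    fix x y assume xy: "x \<in> ?C" "y \<in> ?C" "tent_map a x = tent_map a y"
    have approx: "\<exists>n>0. \<bar>crit a n - (z - 1 / 2) / b\<bar> < \<epsilon>" if z: "z \<in> ?C" "0 < \<epsilon>" for z \<epsilon>
    proof -
      have "0 < b * \<epsilon>" using z b by simp
      then obtain n where n: "1 \<le> n" "dist (1 / 2 + b * crit a n) z < b * \<epsilon>"
        using z(1) by (auto simp: closure_approachable orbit)
      have "b * \<bar>crit a n - (z - 1 / 2) / b\<bar> = \<bar>b * (crit a n - (z - 1 / 2) / b)\<bar>"
        using b by (simp add: abs_mult)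
      also have "b * (crit a n - (z - 1 / 2) / b) = 1 / 2 + b * crit a n - z"
        using b by (simp add: field_simps)
      also have "\<bar>\<dots>\<bar> < b * \<epsilon>" using n by (simp add: dist_real_def)
      finally have "\<bar>crit a n - (z - 1 / 2) / b\<bar> < \<epsilon>" using b by simp
      then show ?thesis using n by (intro exI[of _ n]) simp
    qed
    have "\<bar>x - 1 / 2\<bar> = \<bar>y - 1 / 2\<bar>" using xy(3) a_gt_1 by (simp add: tent_map_eq)
    then consider "x = y" | "(y - 1 / 2) = - (x - 1 / 2)" by linarith
    then show "x = y"
    proof cases
      case 2
      have "(x - 1 / 2) / b = 0"
      proof (rule crit_no_symmetric_limits)
        show "\<exists>n>0. \<bar>crit a n - (x - 1 / 2) / b\<bar> < \<epsilon>" if "0 < \<epsilon>" for \<epsilon>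
          using approx[OF xy(1) that] .
        show "\<exists>n>0. \<bar>crit a n + (x - 1 / 2) / b\<bar> < \<epsilon>" if "0 < \<epsilon>" for \<epsilon>
          using approx[OF xy(2) that] unfolding 2 divide_minus_left diff_minus_eq_add .
      qed
      then show ?thesis using 2 b by simp
    qed
  qed
qed

text \<open>Within one initial window, the sequences \<open>r\<close> with values in
  \<open>{1, 2}\<close> encode the sets of natural numbers, and different sets yield different
  parameters.\<close>

lemma uncountable_good_parameters:
  assumes "sqrt 2 < p" "p < q" "q \<le> 2"
  shows "uncountable {a \<in> {p..q}. \<exists>N r. renorm_tent N r a}"
proof
  assume count: "countable {a \<in> {p..q}. \<exists>N r. renorm_tent N r a}"
  obtain l u e n where win: "p \<le> l" "u \<le> q" "window l u e 2 n 1"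
    using initial_window[OF assms] by blast
  define r :: "nat set \<Rightarrow> nat \<Rightarrow> nat" where "r X i = (if i \<in> X then 2 else 1)" for X i
  have "\<exists>a. a \<in> {l..u} \<and> renorm_tent (levels n (r X)) (r X) a" for X
    using renorm_tent_exists[OF win(3), of "r X"] by (metis r_def zero_less_numeral zero_less_one)
  then obtain h where h: "\<And>X. h X \<in> {l..u}" "\<And>X. renorm_tent (levels n (r X)) (r X) (h X)" by metis
  have "inj h"
  proof (rule injI)
    fix X Y assume "h X = h Y"
    then have "renorm_tent (levels n (r Y)) (r Y) (h X)" using h(2)[of Y] by simp
    then have "r X = r Y" by (rule renorm_tent_inj[OF h(2)]) (auto simp: r_def)
    then have "r X i = r Y i" for i by simp
    then have "i \<in> X \<longleftrightarrow> i \<in> Y" for i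
      unfolding r_def by (metis numeral_eq_one_iff semiring_norm(85))
    then show "X = Y" by blast
  qed
  have "range h \<subseteq> {a \<in> {p..q}. \<exists>N r. renorm_tent N r a}"
  proof (rule image_subsetI)
    fix X
    have "h X \<in> {p..q}" using h(1)[of X] win by auto
    then show "h X \<in> {a \<in> {p..q}. \<exists>N r. renorm_tent N r a}" using h(2)[of X] by blast
  qed
  then have "countable (range h)" using count by (rule countable_subset)
  then have "countable (UNIV :: nat set set)" using \<open>inj h\<close> countable_image_inj_on by blast
  then obtain g :: "nat \<Rightarrow> nat set" where "range g = UNIV"
    using uncountable_def by (metis UNIV_not_empty)
  then show False using Cantors_theorem[of UNIV] by auto
qed

theorem theorem1:
  shows "\<exists>A::real set. A \<subseteq> {sqrt 2..2} \<and> {sqrt 2..2} \<subseteq> closure A \<and>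
    locally_uncountable_in {sqrt 2..2} A \<and>
    (\<forall>a\<in>A. \<exists>g. homeomorphism (omega_limit (tent_map a) (1/2)) (omega_limit (tent_map a) (1/2))
                 (tent_map a) g)"
proof -
  define A where "A = {a \<in> {sqrt 2..2}. \<exists>N r. renorm_tent N r a}"
  have s2: "sqrt 2 < 2" by (rule real_less_lsqrt) auto
  have loc: "uncountable (A \<inter> V)" if V: "open V" "{sqrt 2..2} \<inter> V \<noteq> {}" for V
  proof -
    obtain x where x: "x \<in> {sqrt 2..2}" "x \<in> V" using V by blast
    then obtain \<epsilon> where \<epsilon>: "0 < \<epsilon>" "ball x \<epsilon> \<subseteq> V" using V openE by blast
    \<comment> \<open>\<open>p\<close> and \<open>q\<close> are chosen so that \<open>{p..q}\<close>
      stays in the ball and strictly above \<open>sqrt 2\<close>, even if \<open>x\<close> is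
      \<open>sqrt 2\<close> or \<open>2\<close>.\<close>
    define q where "q = min 2 (x + \<epsilon> / 2)"
    define p where "p = max ((sqrt 2 + q) / 2) (q - \<epsilon> / 4)"
    have q: "x \<le> q" "q \<le> x + \<epsilon> / 2" "q \<le> 2" "sqrt 2 < q"
      using x(1) \<epsilon>(1) s2 by (auto simp: q_def)
    then have p: "sqrt 2 < p" "p < q" "q - \<epsilon> / 4 \<le> p"
      using \<epsilon>(1) by (auto simp: p_def less_max_iff_disj)
    have "{p..q} \<subseteq> ball x \<epsilon>"
      using p q \<epsilon>(1) by (auto simp: dist_real_def abs_less_iff)
    with p q have pq: "sqrt 2 < p" "p < q" "q \<le> 2" "{p..q} \<subseteq> ball x \<epsilon>" by auto
    have "{a \<in> {p..q}. \<exists>N r. renorm_tent N r a} \<subseteq> A \<inter> V" using pq \<epsilon> by (auto simp: A_def)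
    then show ?thesis using uncountable_good_parameters[OF pq(1-3)] countable_subset by blast
  qed
  have "{sqrt 2..2} \<subseteq> closure A"
  proof
    fix x :: real assume x: "x \<in> {sqrt 2..2}"
    have "A \<inter> V \<noteq> {}" if "open V" "x \<in> V" for V
      using loc[OF that(1)] x that(2) by (metis countable_empty disjoint_iff)
    then show "x \<in> closure A" unfolding closure_iff_nhds_not_empty by blast
  qed
  moreover have "locally_uncountable_in {sqrt 2..2} A"
    unfolding locally_uncountable_in_def
  proof (intro allI impI)
    fix U assume "openin (top_of_set {sqrt 2..2}) U \<and> U \<noteq> {}"
    then obtain V where V: "open V" "U = {sqrt 2..2} \<inter> V" "U \<noteq> {}" by (auto simp: openin_open)
    then have "A \<inter> U = A \<inter> V" by (auto simp: A_def)
    then show "uncountable (A \<inter> U)" using loc V by simp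
  qed
  moreover have "\<exists>g. homeomorphism (omega_limit (tent_map a) (1/2)) (omega_limit (tent_map a) (1/2)) (tent_map a) g"
    if "a \<in> A" for a
    using that renorm_tent_homeomorphism by (auto simp: A_def)
  moreover have "A \<subseteq> {sqrt 2..2}" by (auto simp: A_def)
  ultimately show ?thesis by blast
qed

end
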